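(* Let $(S_n)_{n\ge 0}$ be a one-dimensional simple symmetric random walk with $S_0=0$, let $\mathcal{K}(n)$ denote its set of favorite edges at time $n$, and let $\tilde{U}(n):=\min\{|x|:x\in\mathcal{K}(n)\}$. For any $\gamma>11$, $$\liminf_{n\to\infty}\frac{\tilde{U}(n)}{\sqrt{n}(\log n)^{-\gamma}}=\infty\qquad \text{almost surely}.$$
   Context: Edges of $\mathbb{Z}$ are indexed by integers: edge $x$ is the edge between the points $x-1$ and $x$. For $i\ge 1$ put $\widetilde{S}_i:=\frac{S_i+S_{i-1}+1}{2}$, which is the edge crossed by the $i$-th jump. The local time on edge $x\in\mathbb{Z}$ at time $n\ge1$ is $L(x,n):=\#\{1\le j\le n:\widetilde{S}_j=x\}$. Edge $x$ is a favorite edge at time $n$ if $L(x,n)=\sup_{y\in\mathbb{Z}}L(y,n)$, and $\mathcal{K}(n)$ is the set of all favorite edges at time $n$. *)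

theory Defs
  imports "HOL-Probability.Probability"
begin

locale simple_symmetric_random_walk = prob_space M for M :: "'a measure" +
  fixes S :: "nat \<Rightarrow> 'a \<Rightarrow> int"
  assumes start: "\<And>\<omega>. \<omega> \<in> space M \<Longrightarrow> S 0 \<omega> = 0"
    and indep_steps:
      "indep_vars (\<lambda>_. count_space UNIV) (\<lambda>n \<omega>. S (Suc n) \<omega> - S n \<omega>) UNIV"
    and step_up: "\<And>n. \<P>(\<omega> in M. S (Suc n) \<omega> - S n \<omega> = 1) = 1 / 2"
    and step_down: "\<And>n. \<P>(\<omega> in M. S (Suc n) \<omega> - S n \<omega> = - 1) = 1 / 2"

text \<open>
  The remaining notions refer to a single path \<open>s\<close>.  Edge \<open>x\<close> joins the points
  \<open>x - 1\<close> and \<open>x\<close>.  The integer division in the next definition is exact whenever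
  the \<open>i\<close>-th step of \<open>s\<close> is \<open>1\<close> or \<open>- 1\<close>; the index \<open>i\<close> is meant to be at least \<open>1\<close>.
\<close>

definition crossed_edge :: "(nat \<Rightarrow> int) \<Rightarrow> nat \<Rightarrow> int" where
  "crossed_edge s i = (s i + s (i - 1) + 1) div 2"

definition edge_local_time :: "(nat \<Rightarrow> int) \<Rightarrow> int \<Rightarrow> nat \<Rightarrow> nat" where
  "edge_local_time s x n = card {j. 1 \<le> j \<and> j \<le> n \<and> crossed_edge s j = x}"

definition favorite_edges :: "(nat \<Rightarrow> int) \<Rightarrow> nat \<Rightarrow> int set" where
  "favorite_edges s n = {x. edge_local_time s x n = (SUP y. edge_local_time s y n)}"

text \<open>
  For \<open>n \<ge> 1\<close> the set of favorite edges is finite and nonempty, so \<open>Min\<close> is the actual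
  minimum; the value at \<open>n = 0\<close>, where every edge is favorite, is not meaningful.
\<close>

definition min_abs_favorite_edge :: "(nat \<Rightarrow> int) \<Rightarrow> nat \<Rightarrow> int" where
  "min_abs_favorite_edge s n = Min {\<bar>x\<bar> | x. x \<in> favorite_edges s n}"

end

theory Submission
  imports Defs "HOL-Real_Asymp.Real_Asymp"
begin

text \<open>
Why favorite edges stay away from the origin.  Fix the moment at which the walk has left the origin
\<open>r\<close> times and stands there again.  Seen from the origin outwards, the numbers of crossings of the
edges to the right form a critical branching process with geometric offspring, the discrete
Ray--Knight description: each down step out of a vertex closes one excursion from the vertex below
it, and the number of up steps between two consecutive down steps is geometric.  The left side carries a second branching process of
the same kind, and the two start with \<open>a\<close> and \<open>r - a\<close> individuals if \<open>a\<close> of the \<open>r\<close> departures went up.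
Given \<open>a\<close> they are independent.

A critical branching process is a martingale that dies out, so from \<open>a\<close> individuals it stays below
a level \<open>m\<close> with probability at most about \<open>1 - a / m\<close> (\<open>prob_extinct_below_le\<close>).  If
\<open>m = (1 + \<delta>) r / 2\<close>, both sides stay below \<open>m\<close> with probability of order \<open>\<delta>\<^sup>2\<close>
(\<open>prob_both_sides_small\<close>).  In contrast, near the origin the process has hardly moved from
its mean \<open>r / 2\<close>: by a maximal inequality of second order, it exceeds \<open>m\<close> within \<open>h\<close> edges with
probability of order \<open>h / (\<delta>\<^sup>2 r)\<close> (\<open>prob_right_overshoot\<close>).  Outside these two events some edge
has been crossed more often than every edge within distance \<open>h\<close>.

This survives from one value of \<open>r\<close> to the next value \<open>(1 + \<delta>) r\<close> because local times only
increase: the far edge is controlled at the beginning of the interval, the near edges at its end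
(\<open>favorite_far_from_origin\<close>).  Within the time block from \<open>2^j\<close> to \<open>2^(j+1)\<close> the number of
departures from the origin is at least \<open>2^(j/2) j^(-3/2)\<close> up to an error of probability of order
\<open>j^(-3/2)\<close> (\<open>prob_local_time_less\<close>), so of order \<open>j / \<delta>\<close> values of \<open>r\<close> have to be examined.  With
\<open>\<delta> = j^(-9/4)\<close> and \<open>h = 2^(j/2) j^(-11)\<close> the errors are summable in \<open>j\<close>, and the first
Borel--Cantelli lemma gives a lower bound with exponent \<open>11\<close>; any larger exponent then
yields an infinite limit inferior.

The branching structure becomes visible when every vertex owns a stack of independent fair
bits and the walk, at each visit, takes the next bit of the stack as the direction of its step.
This walk has the law of the simple random walk because no bit is ever used twice
(\<open>fair_on_step_bits\<close>), while the two branching processes are functions of disjoint sets of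
stacks.  All events involve finitely many bits, so probabilities are counts of bit patterns and
carry over from the stack-driven walk to any simple random walk.
\<close>

section \<open>Families of fair bits\<close>

definition depends_on :: "(('i \<Rightarrow> bool) \<Rightarrow> bool) \<Rightarrow> 'i set \<Rightarrow> bool" where
  "depends_on Q K \<longleftrightarrow> (\<forall>f g. (\<forall>i\<in>K. f i = g i) \<longrightarrow> Q f = Q g)"

definition bit_prob :: "'a measure \<Rightarrow> ('i \<Rightarrow> 'a \<Rightarrow> bool) \<Rightarrow> (('i \<Rightarrow> bool) \<Rightarrow> bool) \<Rightarrow> real" where
  "bit_prob M \<eta> Q = measure M {\<omega>\<in>space M. Q (\<lambda>i. \<eta> i \<omega>)}"

text \<open>
Fairness is expressed by the weights of patterns instead of by independence: this is the form in
which it is verified for the step bits of the stack-driven walk, and it determines the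
probability of every event that depends on \<open>K\<close> only.
\<close>

definition fair_on :: "'a measure \<Rightarrow> ('i \<Rightarrow> 'a \<Rightarrow> bool) \<Rightarrow> 'i set \<Rightarrow> bool" where
  "fair_on M \<eta> K \<longleftrightarrow> prob_space M \<and> finite K \<and> (\<forall>i\<in>K. {\<omega>\<in>space M. \<eta> i \<omega>} \<in> sets M) \<and>
     (\<forall>A\<subseteq>K. bit_prob M \<eta> (\<lambda>f. \<forall>i\<in>K. f i \<longleftrightarrow> i \<in> A) = 1 / 2 ^ card K)"

definition fair_bits :: "'a measure \<Rightarrow> ('i \<Rightarrow> 'a \<Rightarrow> bool) \<Rightarrow> bool" where
  "fair_bits M \<eta> \<longleftrightarrow> (\<forall>K. finite K \<longrightarrow> fair_on M \<eta> K)"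

lemma depends_onI: "(\<And>f g. (\<And>i. i \<in> K \<Longrightarrow> f i = g i) \<Longrightarrow> Q f \<Longrightarrow> Q g) \<Longrightarrow> depends_on Q K"
  unfolding depends_on_def by (metis (full_types))

lemma depends_onD: "depends_on Q K \<Longrightarrow> (\<And>i. i \<in> K \<Longrightarrow> f i = g i) \<Longrightarrow> Q f = Q g"
  unfolding depends_on_def by blast

lemma depends_on_conj: "depends_on P K \<Longrightarrow> depends_on Q K' \<Longrightarrow> depends_on (\<lambda>f. P f \<and> Q f) (K \<union> K')"
  unfolding depends_on_def by (metis Un_iff)

lemma depends_on_not: "depends_on P K \<Longrightarrow> depends_on (\<lambda>f. \<not> P f) K"
  unfolding depends_on_def by blast

lemma depends_on_pattern:
  "depends_on Q K \<Longrightarrow> Q f \<longleftrightarrow> (\<exists>A. A \<subseteq> K \<and> Q (\<lambda>i. i \<in> A) \<and> (\<forall>i\<in>K. f i \<longleftrightarrow> i \<in> A))"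
proof
  assume d: "depends_on Q K" and "Q f"
  then have "Q (\<lambda>i. i \<in> {i\<in>K. f i})" using depends_onD[OF d, of f "\<lambda>i. i \<in> {i\<in>K. f i}"] by auto
  then show "\<exists>A. A \<subseteq> K \<and> Q (\<lambda>i. i \<in> A) \<and> (\<forall>i\<in>K. f i \<longleftrightarrow> i \<in> A)"
    by (intro exI[of _ "{i\<in>K. f i}"]) auto
next
  assume d: "depends_on Q K" and "\<exists>A. A \<subseteq> K \<and> Q (\<lambda>i. i \<in> A) \<and> (\<forall>i\<in>K. f i \<longleftrightarrow> i \<in> A)"
  then obtain A where A: "Q (\<lambda>i. i \<in> A)" "\<forall>i\<in>K. f i \<longleftrightarrow> i \<in> A" by blast
  have "Q f = Q (\<lambda>i. i \<in> A)" using A(2) by (intro depends_onD[OF d]) auto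
  with A(1) show "Q f" by simp
qed

lemma fair_on_pattern:
  "fair_on M \<eta> K \<Longrightarrow> A \<subseteq> K \<Longrightarrow>
     bit_prob M \<eta> (\<lambda>f. \<forall>i\<in>K. f i \<longleftrightarrow> i \<in> A) = 1 / 2 ^ card K"
  unfolding fair_on_def by blast

lemma fair_on_sets: "fair_on M \<eta> K \<Longrightarrow> i \<in> K \<Longrightarrow> {\<omega>\<in>space M. \<eta> i \<omega>} \<in> sets M"
  unfolding fair_on_def by blast

lemma fair_onI:
  assumes "prob_space M" "finite K" "\<And>i. i \<in> K \<Longrightarrow> {\<omega>\<in>space M. \<eta> i \<omega>} \<in> sets M"
    and "\<And>A. A \<subseteq> K \<Longrightarrow> bit_prob M \<eta> (\<lambda>f. \<forall>i\<in>K. f i \<longleftrightarrow> i \<in> A) = 1 / 2 ^ card K"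
  shows "fair_on M \<eta> K"
  unfolding fair_on_def using assms by blast

lemma fair_on_pattern_sets:
  assumes "fair_on M \<eta> K"
  shows "{\<omega>\<in>space M. \<forall>i\<in>K. \<eta> i \<omega> \<longleftrightarrow> i \<in> A} \<in> sets M"
proof (rule sets.sets_Collect_finite_All)
  show "finite K" using assms by (simp add: fair_on_def)
  fix i assume "i \<in> K"
  then have "{\<omega>\<in>space M. \<eta> i \<omega>} \<in> sets M" using assms by (simp add: fair_on_def)
  then show "{\<omega>\<in>space M. \<eta> i \<omega> \<longleftrightarrow> i \<in> A} \<in> sets M"
    by (cases "i \<in> A") (auto intro: sets.sets_Collect_neg)
qed

lemma bit_event_eq:
  assumes "depends_on Q K"
  shows "{\<omega>\<in>space M. Q (\<lambda>i. \<eta> i \<omega>)} =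
    (\<Union>A\<in>{A. A \<subseteq> K \<and> Q (\<lambda>i. i \<in> A)}. {\<omega>\<in>space M. \<forall>i\<in>K. \<eta> i \<omega> \<longleftrightarrow> i \<in> A})"
proof (rule set_eqI)
  fix \<omega>
  show "\<omega> \<in> {\<omega>\<in>space M. Q (\<lambda>i. \<eta> i \<omega>)} \<longleftrightarrow> \<omega> \<in>
    (\<Union>A\<in>{A. A \<subseteq> K \<and> Q (\<lambda>i. i \<in> A)}. {\<omega>\<in>space M. \<forall>i\<in>K. \<eta> i \<omega> \<longleftrightarrow> i \<in> A})"
    unfolding mem_Collect_eq UN_iff depends_on_pattern[OF assms, of "\<lambda>i. \<eta> i \<omega>"] by blast
qed

lemma bit_event_sets:
  assumes f: "fair_on M \<eta> K" and d: "depends_on Q K"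
  shows "{\<omega>\<in>space M. Q (\<lambda>i. \<eta> i \<omega>)} \<in> sets M"
proof -
  have "finite {A. A \<subseteq> K \<and> Q (\<lambda>i. i \<in> A)}" using f by (auto simp: fair_on_def)
  then show ?thesis
    unfolding bit_event_eq[OF d] by (intro sets.finite_UN fair_on_pattern_sets[OF f])
qed

text \<open>
The patterns on \<open>K\<close> partition the probability space into events of equal weight.  In particular the
probability does not depend on the space, which transfers statements between different
realisations of a random walk.
\<close>

lemma bit_prob_eq_count:
  assumes f: "fair_on M \<eta> K" and d: "depends_on Q K"
  shows "bit_prob M \<eta> Q = real (card {A. A \<subseteq> K \<and> Q (\<lambda>i. i \<in> A)}) / 2 ^ card K"
proof -
  interpret prob_space M using f by (simp add: fair_on_def)
  let ?I = "{A. A \<subseteq> K \<and> Q (\<lambda>i. i \<in> A)}"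
  let ?E = "\<lambda>A. {\<omega>\<in>space M. \<forall>i\<in>K. \<eta> i \<omega> \<longleftrightarrow> i \<in> A}"
  have fin: "finite ?I" using f by (auto simp: fair_on_def)
  have "disjoint_family_on ?E ?I"
    unfolding disjoint_family_on_def
  proof (intro ballI impI)
    fix A B assume "A \<in> ?I" "B \<in> ?I" "A \<noteq> B"
    then obtain i where "i \<in> K" "(i \<in> A) \<noteq> (i \<in> B)" by blast
    then show "?E A \<inter> ?E B = {}" by auto
  qed
  then have "prob (\<Union>A\<in>?I. ?E A) = (\<Sum>A\<in>?I. prob (?E A))"
    using fin fair_on_pattern_sets[OF f] by (intro finite_measure_finite_Union) auto
  also have "\<dots> = (\<Sum>A\<in>?I. 1 / 2 ^ card K)"
    using fair_on_pattern[OF f] by (intro sum.cong) (auto simp: bit_prob_def)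
  finally show ?thesis unfolding bit_prob_def bit_event_eq[OF d] by simp
qed

lemma fair_bits_fair_on: "fair_bits M \<eta> \<Longrightarrow> finite K \<Longrightarrow> fair_on M \<eta> K"
  by (simp add: fair_bits_def)

text \<open>
A subset of a disjoint union is a pair of subsets, so counting patterns gives a product.
\<close>

lemma bit_prob_indep:
  assumes f: "fair_bits M \<eta>" and fin: "finite K" "finite L" and disj: "K \<inter> L = {}"
    and dep: "depends_on P K" "depends_on Q L"
  shows "bit_prob M \<eta> (\<lambda>f. P f \<and> Q f) = bit_prob M \<eta> P * bit_prob M \<eta> Q"
proof -
  let ?C = "\<lambda>R J. {A. A \<subseteq> J \<and> R (\<lambda>i. i \<in> A)}"
  have P: "P (\<lambda>i. i \<in> A) = P (\<lambda>i. i \<in> A \<inter> K)" for A by (rule depends_onD[OF dep(1)]) auto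
  have Q: "Q (\<lambda>i. i \<in> A) = Q (\<lambda>i. i \<in> A \<inter> L)" for A by (rule depends_onD[OF dep(2)]) auto
  have "bij_betw (\<lambda>A. (A \<inter> K, A \<inter> L)) (?C (\<lambda>f. P f \<and> Q f) (K \<union> L)) (?C P K \<times> ?C Q L)"
  proof (rule bij_betw_byWitness[where f' = "\<lambda>(A, B). A \<union> B"])
    show "(\<lambda>(A, B). A \<union> B) ` (?C P K \<times> ?C Q L) \<subseteq> ?C (\<lambda>f. P f \<and> Q f) (K \<union> L)"
    proof safe
      fix A B assume A: "A \<subseteq> K" "P (\<lambda>i. i \<in> A)" and B: "B \<subseteq> L" "Q (\<lambda>i. i \<in> B)"
      have "(A \<union> B) \<inter> K = A" "(A \<union> B) \<inter> L = B" using A(1) B(1) disj by auto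
      then show "P (\<lambda>i. i \<in> A \<union> B)" "Q (\<lambda>i. i \<in> A \<union> B)"
        using P[of "A \<union> B"] Q[of "A \<union> B"] A B by auto
    qed auto
  qed (use P Q disj in auto)
  then have "card (?C (\<lambda>f. P f \<and> Q f) (K \<union> L)) = card (?C P K) * card (?C Q L)"
    by (simp add: bij_betw_same_card card_cartesian_product)
  moreover have "card (K \<union> L) = card K + card L" using fin disj by (rule card_Un_disjoint)
  ultimately show ?thesis
    using bit_prob_eq_count[OF fair_bits_fair_on[OF f fin(1)] dep(1)]
      bit_prob_eq_count[OF fair_bits_fair_on[OF f fin(2)] dep(2)]
      bit_prob_eq_count[OF fair_bits_fair_on[OF f finite_UnI[OF fin]] depends_on_conj[OF dep]]
    by (simp add: power_add)
qed

lemma fair_bits_reindex: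
  fixes \<eta> :: "'i \<Rightarrow> 'a \<Rightarrow> bool" and e :: "'j \<Rightarrow> 'i"
  assumes f: "fair_bits M \<eta>" and e: "inj e"
  shows "fair_bits M (\<lambda>i. \<eta> (e i))"
  unfolding fair_bits_def
proof (intro allI impI)
  fix K :: "'j set" assume K: "finite K"
  have *: "fair_on M \<eta> (e ` K)" using fair_bits_fair_on[OF f] K by simp
  have "bit_prob M (\<lambda>i. \<eta> (e i)) (\<lambda>f. \<forall>i\<in>K. f i \<longleftrightarrow> i \<in> A) = 1 / 2 ^ card K" if A: "A \<subseteq> K" for A
  proof -
    have "bit_prob M (\<lambda>i. \<eta> (e i)) (\<lambda>f. \<forall>i\<in>K. f i \<longleftrightarrow> i \<in> A)
      = bit_prob M \<eta> (\<lambda>f. \<forall>i\<in>e ` K. f i \<longleftrightarrow> i \<in> e ` A)"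
      using e by (simp add: bit_prob_def inj_image_mem_iff)
    also have "\<dots> = 1 / 2 ^ card (e ` K)" using A by (intro fair_on_pattern[OF *]) auto
    finally show ?thesis using e by (simp add: card_image inj_on_subset)
  qed
  moreover have "prob_space M" using * by (simp add: fair_on_def)
  ultimately show "fair_on M (\<lambda>i. \<eta> (e i)) K"
    using fair_on_sets[OF *] K by (intro fair_onI) auto
qed

lemma fair_bits_not:
  fixes \<eta> :: "'i \<Rightarrow> 'a \<Rightarrow> bool"
  assumes f: "fair_bits M \<eta>"
  shows "fair_bits M (\<lambda>i \<omega>. \<not> \<eta> i \<omega>)"
  unfolding fair_bits_def
proof (intro allI impI)
  fix K :: "'i set" assume K: "finite K"
  have *: "fair_on M \<eta> K" using fair_bits_fair_on[OF f] K by simp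
  have "bit_prob M (\<lambda>i \<omega>. \<not> \<eta> i \<omega>) (\<lambda>f. \<forall>i\<in>K. f i \<longleftrightarrow> i \<in> A) = 1 / 2 ^ card K" if A: "A \<subseteq> K" for A
  proof -
    have "(\<forall>i\<in>K. (\<not> f i) = (i \<in> A)) \<longleftrightarrow> (\<forall>i\<in>K. f i = (i \<in> K - A))" for f by auto
    then have "bit_prob M (\<lambda>i \<omega>. \<not> \<eta> i \<omega>) (\<lambda>f. \<forall>i\<in>K. f i \<longleftrightarrow> i \<in> A)
      = bit_prob M \<eta> (\<lambda>f. \<forall>i\<in>K. f i \<longleftrightarrow> i \<in> K - A)"
      by (simp add: bit_prob_def)
    also have "\<dots> = 1 / 2 ^ card K" by (rule fair_on_pattern[OF *]) auto
    finally show ?thesis .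
  qed
  moreover have "prob_space M" using * by (simp add: fair_on_def)
  ultimately show "fair_on M (\<lambda>i \<omega>. \<not> \<eta> i \<omega>) K"
    using fair_on_sets[OF *] K by (intro fair_onI) (auto intro: sets.sets_Collect_neg)
qed

lemma fair_bitsI_indep:
  fixes X :: "'i \<Rightarrow> 'a \<Rightarrow> bool"
  assumes "prob_space M" and ind: "prob_space.indep_vars M (\<lambda>_. count_space UNIV) X UNIV"
    and half: "\<And>i. measure M {\<omega>\<in>space M. X i \<omega> = True} = 1 / 2"
  shows "fair_bits M X"
proof -
  interpret prob_space M by fact
  have meas: "X i \<in> measurable M (count_space UNIV)" for i
    using ind by (auto simp: indep_vars_def)
  have sets: "{\<omega>\<in>space M. X i \<omega>} \<in> sets M" for i
    using measurable_sets[OF meas, of "{True}" i] by (simp add: vimage_def Int_def conj_commute)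
  have half': "prob (X i -` {b} \<inter> space M) = 1/2" for i b
  proof (cases b)
    case True
    then show ?thesis using half[of i] by (simp add: vimage_def Int_def conj_commute)
  next
    case False
    have "X i -` {False} \<inter> space M = space M - {\<omega>\<in>space M. X i \<omega>}" by auto
    then show ?thesis using False half[of i] prob_compl[OF sets[of i]] by simp
  qed
  show ?thesis
    unfolding fair_bits_def
  proof (intro allI impI)
    fix K :: "'i set" assume K: "finite K"
    have "bit_prob M X (\<lambda>f. \<forall>i\<in>K. f i \<longleftrightarrow> i \<in> A) = 1 / 2 ^ card K" if A: "A \<subseteq> K" for A
    proof (cases "K = {}")
      case True
      then show ?thesis by (simp add: bit_prob_def prob_space)
    next
      case False
      have "bit_prob M X (\<lambda>f. \<forall>i\<in>K. f i \<longleftrightarrow> i \<in> A) = prob (\<Inter>i\<in>K. X i -` {i \<in> A} \<inter> space M)"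
        unfolding bit_prob_def using False by (intro arg_cong[where f = prob]) auto
      also have "\<dots> = (\<Prod>i\<in>K. prob (X i -` {i \<in> A} \<inter> space M))"
        using False K by (intro indep_varsD[OF ind]) auto
      also have "\<dots> = (1/2) ^ card K" by (simp add: half')
      finally show ?thesis by (simp add: power_one_over)
    qed
    then show "fair_on M X K"
      using K sets prob_space_axioms by (intro fair_onI) auto
  qed
qed

lemma bit_prob_nonneg [simp]: "bit_prob M \<eta> Q \<ge> 0"
  by (simp add: bit_prob_def)

lemma fair_bits_prob_space: "fair_bits M \<eta> \<Longrightarrow> prob_space M"
  using fair_bits_fair_on[of M \<eta> "{}"] by (simp add: fair_on_def)

lemma bit_prob_le_1: "fair_bits M \<eta> \<Longrightarrow> bit_prob M \<eta> Q \<le> 1"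
  using prob_space.prob_le_1[OF fair_bits_prob_space] by (simp add: bit_prob_def)

lemma bit_prob_const: "fair_bits M \<eta> \<Longrightarrow> bit_prob M \<eta> (\<lambda>_. b) = of_bool b"
  using prob_space.prob_space[OF fair_bits_prob_space[of M \<eta>]] by (simp add: bit_prob_def)

lemma fair_bits_event: "fair_bits M \<eta> \<Longrightarrow> finite K \<Longrightarrow> depends_on Q K \<Longrightarrow>
    {\<omega>\<in>space M. Q (\<lambda>i. \<eta> i \<omega>)} \<in> sets M"
  by (rule bit_event_sets[OF fair_bits_fair_on])

lemma bit_prob_not:
  assumes f: "fair_bits M \<eta>" and K: "finite K" "depends_on Q K"
  shows "bit_prob M \<eta> (\<lambda>f. \<not> Q f) = 1 - bit_prob M \<eta> Q"
proof -
  interpret prob_space M by (rule fair_bits_prob_space[OF f])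
  show ?thesis
    unfolding bit_prob_def by (rule prob_neg[OF fair_bits_event[OF f K]])
qed

lemma bit_prob_disjoint_Ex:
  assumes f: "fair_bits M \<eta>" and I: "finite I"
    and K: "\<And>z. z \<in> I \<Longrightarrow> finite (K z)" "\<And>z. z \<in> I \<Longrightarrow> depends_on (Q z) (K z)"
    and disj: "\<And>z z' g. Q z g \<Longrightarrow> Q z' g \<Longrightarrow> z = z'"
  shows "bit_prob M \<eta> (\<lambda>g. \<exists>z\<in>I. Q z g) = (\<Sum>z\<in>I. bit_prob M \<eta> (Q z))"
proof -
  interpret prob_space M by (rule fair_bits_prob_space[OF f])
  let ?E = "\<lambda>z. {\<omega>\<in>space M. Q z (\<lambda>i. \<eta> i \<omega>)}"
  have "prob (\<Union>z\<in>I. ?E z) = (\<Sum>z\<in>I. prob (?E z))"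
  proof (rule finite_measure_finite_Union[OF I])
    show "?E ` I \<subseteq> sets M" using fair_bits_event[OF f K] by auto
    show "disjoint_family_on ?E I"
      unfolding disjoint_family_on_def
    proof (intro ballI impI)
      fix z z' assume "z \<in> I" "z' \<in> I" "z \<noteq> z'"
      then show "?E z \<inter> ?E z' = {}" using disj by blast
    qed
  qed
  moreover have "(\<Union>z\<in>I. ?E z) = {\<omega>\<in>space M. \<exists>z\<in>I. Q z (\<lambda>i. \<eta> i \<omega>)}" by blast
  ultimately show ?thesis by (simp add: bit_prob_def)
qed

lemma depends_on_reindex:
  assumes "depends_on Q K"
  shows "depends_on (\<lambda>f. Q (\<lambda>i. f (e i))) (e ` K)"
proof (rule depends_onI)
  fix f g assume fg: "\<And>j. j \<in> e ` K \<Longrightarrow> f j = g j" and Q: "Q (\<lambda>i. f (e i))"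
  have "Q (\<lambda>i. f (e i)) = Q (\<lambda>i. g (e i))" by (rule depends_onD[OF assms]) (simp add: fg)
  with Q show "Q (\<lambda>i. g (e i))" by simp
qed

lemma depends_on_Bex:
  "(\<And>a. a \<in> I \<Longrightarrow> depends_on (Q a) (K a)) \<Longrightarrow> depends_on (\<lambda>f. \<exists>a\<in>I. Q a f) (\<Union>a\<in>I. K a)"
proof (rule depends_onI)
  fix f g
  assume Q: "\<And>a. a \<in> I \<Longrightarrow> depends_on (Q a) (K a)"
    and fg: "\<And>i. i \<in> (\<Union>a\<in>I. K a) \<Longrightarrow> f i = g i" and "\<exists>a\<in>I. Q a f"
  then obtain a where a: "a \<in> I" "Q a f" by blast
  have "Q a f = Q a g" by (rule depends_onD[OF Q[OF a(1)]]) (use fg a(1) in blast)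
  with a show "\<exists>a\<in>I. Q a g" by blast
qed

text \<open>
Finitary events are measurable for every fair family, which keeps infinite products out of the
estimates.
\<close>

definition finitary :: "(('i \<Rightarrow> bool) \<Rightarrow> bool) \<Rightarrow> bool" where
  "finitary Q \<longleftrightarrow> (\<exists>K. finite K \<and> depends_on Q K)"

lemma finitary_event: "fair_bits M \<eta> \<Longrightarrow> finitary Q \<Longrightarrow> {\<omega>\<in>space M. Q (\<lambda>i. \<eta> i \<omega>)} \<in> sets M"
  unfolding finitary_def using fair_bits_event by blast

lemma finitary_disj: "finitary P \<Longrightarrow> finitary Q \<Longrightarrow> finitary (\<lambda>f. P f \<or> Q f)"
  unfolding finitary_def
proof (elim exE conjE)
  fix K L assume "finite K" "depends_on P K" "finite L" "depends_on Q L"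
  then have "finite (K \<union> L) \<and> depends_on (\<lambda>f. \<not> (\<not> P f \<and> \<not> Q f)) (K \<union> L)"
    by (intro conjI depends_on_not depends_on_conj) auto
  then show "\<exists>K. finite K \<and> depends_on (\<lambda>f. P f \<or> Q f) K" by auto
qed

lemma finitary_Bex:
  assumes "finite I" "\<And>i. i \<in> I \<Longrightarrow> finitary (Q i)"
  shows "finitary (\<lambda>f. \<exists>i\<in>I. Q i f)"
proof -
  from assms(2) obtain K where K: "\<And>i. i \<in> I \<Longrightarrow> finite (K i) \<and> depends_on (Q i) (K i)"
    unfolding finitary_def by metis
  then have "depends_on (\<lambda>f. \<exists>i\<in>I. Q i f) (\<Union>i\<in>I. K i)" by (intro depends_on_Bex) auto
  with K assms(1) show ?thesis unfolding finitary_def by blast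
qed

lemma bit_prob_mono:
  assumes f: "fair_bits M \<eta>" and Q: "finitary Q" and le: "\<And>f. P f \<Longrightarrow> Q f"
  shows "bit_prob M \<eta> P \<le> bit_prob M \<eta> Q"
proof -
  interpret prob_space M by (rule fair_bits_prob_space[OF f])
  show ?thesis
    unfolding bit_prob_def by (rule finite_measure_mono[OF _ finitary_event[OF f Q]]) (use le in auto)
qed

lemma bit_prob_disj_le:
  assumes f: "fair_bits M \<eta>" and P: "finitary P" and Q: "finitary Q"
  shows "bit_prob M \<eta> (\<lambda>f. P f \<or> Q f) \<le> bit_prob M \<eta> P + bit_prob M \<eta> Q"
proof -
  interpret prob_space M by (rule fair_bits_prob_space[OF f])
  have "{\<omega>\<in>space M. P (\<lambda>i. \<eta> i \<omega>) \<or> Q (\<lambda>i. \<eta> i \<omega>)}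
      = {\<omega>\<in>space M. P (\<lambda>i. \<eta> i \<omega>)} \<union> {\<omega>\<in>space M. Q (\<lambda>i. \<eta> i \<omega>)}" by blast
  then show ?thesis
    unfolding bit_prob_def using measure_Un_le[OF finitary_event[OF f P] finitary_event[OF f Q]] by simp
qed

lemma bit_prob_Bex_le:
  assumes f: "fair_bits M \<eta>" and I: "finite I" and Q: "\<And>i. i \<in> I \<Longrightarrow> finitary (Q i)"
  shows "bit_prob M \<eta> (\<lambda>f. \<exists>i\<in>I. Q i f) \<le> (\<Sum>i\<in>I. bit_prob M \<eta> (Q i))"
proof -
  interpret prob_space M by (rule fair_bits_prob_space[OF f])
  have "{\<omega>\<in>space M. \<exists>i\<in>I. Q i (\<lambda>i. \<eta> i \<omega>)} = (\<Union>i\<in>I. {\<omega>\<in>space M. Q i (\<lambda>i. \<eta> i \<omega>)})" by blast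
  then show ?thesis
    unfolding bit_prob_def using finitary_event[OF f Q] I
    by (simp add: measure_UNION_le)
qed

definition coin_space :: "('i \<Rightarrow> bool) measure" where
  "coin_space = PiM UNIV (\<lambda>_. measure_pmf (bernoulli_pmf (1/2)))"

lemma fair_bits_coin_space: "fair_bits coin_space (\<lambda>i \<omega>. \<omega> i)"
  unfolding fair_bits_def
proof (intro allI impI)
  fix K :: "'i set" assume K: "finite K"
  interpret product_prob_space "\<lambda>_::'i. measure_pmf (bernoulli_pmf (1/2))" UNIV
    by standard
  have P: "prob_space (coin_space :: ('i \<Rightarrow> bool) measure)"
    unfolding coin_space_def by (rule prob_space_PiM) (rule measure_pmf.prob_space_axioms)
  have sp: "space (coin_space :: ('i \<Rightarrow> bool) measure) = UNIV"
    by (simp add: coin_space_def space_PiM)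
  have "bit_prob coin_space (\<lambda>i \<omega>. \<omega> i) (\<lambda>f. \<forall>i\<in>K. f i \<longleftrightarrow> i \<in> A) = 1 / 2 ^ card K" if A: "A \<subseteq> K" for A
  proof -
    have "emeasure coin_space {\<omega>\<in>space coin_space. \<forall>i\<in>K. \<omega> i \<in> {i \<in> A}}
      = (\<Prod>i\<in>K. emeasure (measure_pmf (bernoulli_pmf (1/2))) {i \<in> A})"
      unfolding coin_space_def by (rule emeasure_PiM_Collect) (use K in auto)
    also have "\<dots> = (\<Prod>i\<in>K. ennreal (1/2))"
      by (intro prod.cong) (auto simp: emeasure_pmf_single)
    also have "\<dots> = ennreal ((1/2) ^ card K)"
      by (simp only: prod_constant ennreal_power)
    finally show ?thesis
      by (simp add: bit_prob_def measure_def power_one_over)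
  qed
  moreover have "{\<omega>\<in>space coin_space. \<omega> i} \<in> sets coin_space" for i :: 'i
  proof -
    have "(\<lambda>\<omega>. \<omega> i) \<in> measurable coin_space (measure_pmf (bernoulli_pmf (1/2)))"
      unfolding coin_space_def by (rule measurable_component_singleton) simp
    from measurable_sets[OF this, of "{True}"] show ?thesis
      by (simp add: vimage_def Int_def conj_commute)
  qed
  ultimately show "fair_on coin_space (\<lambda>i \<omega>. \<omega> i) K"
    using K P by (intro fair_onI) auto
qed

section \<open>The negative binomial law\<close>

text \<open>
The number of heads before the \<open>a\<close>-th tail of a fair coin.  For \<open>a = 0\<close> truncated subtraction makes
the binomial coefficient \<open>1\<close> at \<open>z = 0\<close> and \<open>0\<close> elsewhere, so this is the point mass at \<open>0\<close>.
\<close>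

definition negbin :: "nat \<Rightarrow> nat \<Rightarrow> real" where
  "negbin a z = real ((a + z - 1) choose z) / 2 ^ (a + z)"

lemma negbin_nonneg [simp]: "negbin a z \<ge> 0"
  by (simp add: negbin_def)

lemma negbin_eq_pmf: "negbin a z = pmf (neg_binomial_pmf a (1/2)) z"
  by (simp add: negbin_def pmf_neg_binomial power_add power_one_over field_simps)

text \<open>
Both the moments and the tail bound below come from this recurrence by telescoping.
\<close>

lemma negbin_Suc: "2 * (real z + 1) * negbin a (Suc z) = (real z + real a) * negbin a z"
proof (cases "a + z")
  case 0
  then show ?thesis by (simp add: negbin_def)
next
  case (Suc n)
  have "Suc z * (Suc n choose Suc z) = Suc n * (n choose z)"
    by (rule Suc_times_binomial)
  then have "real (Suc z) * real (Suc n choose Suc z) = real (Suc n) * real (n choose z)"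
    by (metis of_nat_mult)
  moreover have "a + Suc z - 1 = Suc n" "a + z - 1 = n" "real z + real a = real (Suc n)"
    "a + Suc z = Suc (Suc n)"
    using Suc by linarith+
  moreover have "2 * (real z + 1) * (c / 2 ^ Suc (Suc n)) = real (Suc z) * c / 2 ^ Suc n" for c :: real
    by (simp add: field_simps)
  ultimately show ?thesis
    unfolding negbin_def using Suc by (simp del: binomial_Suc_Suc of_nat_Suc power_Suc)
qed

lemma negbin_sums_1: "negbin a sums 1"
proof -
  have "integrable (count_space UNIV) (pmf (neg_binomial_pmf a (1/2)))"
    by (rule integrable_pmf)
  then have "pmf (neg_binomial_pmf a (1/2)) sums
      integral\<^sup>L (count_space UNIV) (pmf (neg_binomial_pmf a (1/2)))"
    by (rule sums_integral_count_space_nat)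
  also have "integral\<^sup>L (count_space UNIV) (pmf (neg_binomial_pmf a (1/2))) = 1"
    by (simp add: integral_pmf)
  finally show ?thesis by (simp add: negbin_eq_pmf[abs_def])
qed

lemma negbin_square_tendsto_0: "(\<lambda>z. (real z + 1)\<^sup>2 * negbin a z) \<longlonglongrightarrow> 0"
proof -
  let ?t = "\<lambda>z. (real z + 1)\<^sup>2 * negbin a z"
  have "eventually (\<lambda>z. (real z + 2)\<^sup>2 * (real z + real a) / (2 * (real z + 1)) \<le> 3/4 * (real z + 1)\<^sup>2) sequentially"
    by real_asymp
  then obtain N where N: "\<And>z. z \<ge> N \<Longrightarrow>
      (real z + 2)\<^sup>2 * (real z + real a) / (2 * (real z + 1)) \<le> 3/4 * (real z + 1)\<^sup>2"
    by (auto simp: eventually_sequentially)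
  have "summable ?t"
  proof (rule summable_ratio_test[where c = "3/4" and N = N])
    fix z assume z: "z \<ge> N"
    have "negbin a (Suc z) = (real z + real a) / (2 * (real z + 1)) * negbin a z"
      using negbin_Suc[of z a] by (simp add: field_simps)
    then have "?t (Suc z) = ((real z + 2)\<^sup>2 * (real z + real a) / (2 * (real z + 1))) * negbin a z"
      by (simp add: algebra_simps)
    also have "\<dots> \<le> (3/4 * (real z + 1)\<^sup>2) * negbin a z"
      by (intro mult_right_mono N z) auto
    finally show "norm (?t (Suc z)) \<le> 3/4 * norm (?t z)" by simp
  qed simp
  then show ?thesis by (rule summable_LIMSEQ_zero)
qed

lemma negbin_linear_tendsto_0: "(\<lambda>z. (real z + 1) * negbin a z) \<longlonglongrightarrow> 0"
proof (rule tendsto_sandwich[OF _ _ tendsto_const negbin_square_tendsto_0[of a]])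
  show "\<forall>\<^sub>F z in sequentially. (real z + 1) * negbin a z \<le> (real z + 1)\<^sup>2 * negbin a z"
    by (intro always_eventually allI mult_right_mono) (auto simp: power2_eq_square field_simps)
qed auto

lemma sum_negbin_first_moment:
  "(\<Sum>z<n. (real a - real z) * negbin a z) = 2 * real n * negbin a n"
proof (induction n)
  case (Suc n)
  then show ?case using negbin_Suc[of n a] by (simp add: algebra_simps)
qed auto

lemma negbin_centred_sums: "(\<lambda>z. (real a - real z) * negbin a z) sums 0"
  unfolding sums_def sum_negbin_first_moment
proof (rule tendsto_sandwich[OF _ _ tendsto_const tendsto_mult_right_zero[OF negbin_linear_tendsto_0[of a]]])
  show "\<forall>\<^sub>F n in sequentially. 2 * real n * negbin a n \<le> 2 * ((real n + 1) * negbin a n)"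
    by (intro always_eventually allI) (simp add: algebra_simps)
qed auto

lemma negbin_mean_sums: "(\<lambda>z. real z * negbin a z) sums real a"
proof -
  have "(\<lambda>z. real a * negbin a z - (real a - real z) * negbin a z) sums (real a * 1 - 0)"
    by (intro sums_diff sums_mult negbin_sums_1 negbin_centred_sums)
  then show ?thesis by (simp add: algebra_simps)
qed

lemma sum_negbin_second_moment:
  "(\<Sum>z<n. (real z * (real a - real z) + (real z + real a)) * negbin a z)
     = 2 * (real n)\<^sup>2 * negbin a n"
proof (induction n)
  case (Suc n)
  have "2 * (real (Suc n))\<^sup>2 * negbin a (Suc n) = (real n + 1) * (2 * (real n + 1) * negbin a (Suc n))"
    by (simp add: power2_eq_square algebra_simps)
  then have "2 * (real (Suc n))\<^sup>2 * negbin a (Suc n) = (real n + 1) * ((real n + real a) * negbin a n)"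
    by (simp only: negbin_Suc)
  with Suc show ?case by (simp add: power2_eq_square algebra_simps)
qed auto

lemma negbin_second_moment_sums: "(\<lambda>z. (real z)\<^sup>2 * negbin a z) sums ((real a)\<^sup>2 + 2 * real a)"
proof -
  have "(\<lambda>z. (real z * (real a - real z) + (real z + real a)) * negbin a z) sums 0"
    unfolding sums_def sum_negbin_second_moment
  proof (rule tendsto_sandwich[OF _ _ tendsto_const tendsto_mult_right_zero[OF negbin_square_tendsto_0[of a]]])
    show "\<forall>\<^sub>F n in sequentially. 2 * (real n)\<^sup>2 * negbin a n \<le> 2 * ((real n + 1)\<^sup>2 * negbin a n)"
      by (intro always_eventually allI)
        (auto simp: power2_eq_square algebra_simps intro!: add_nonneg_nonneg mult_nonneg_nonneg)
  qed auto
  then have "(\<lambda>z. (real a + 1) * (real z * negbin a z) + real a * negbin a z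
      - (real z * (real a - real z) + (real z + real a)) * negbin a z)
      sums ((real a + 1) * real a + real a * 1 - 0)"
    by (intro sums_diff sums_add sums_mult negbin_sums_1 negbin_mean_sums)
  then show ?thesis by (simp add: power2_eq_square algebra_simps)
qed

text \<open>
The mean is \<open>a\<close> and the variance \<open>2 * a\<close>.  Hence the quadratic on the left, with \<open>N\<close> further
generations to come, turns into the same quadratic with \<open>N + 1\<close> generations: a
martingale of second order for the branching process.
\<close>

lemma negbin_quadratic_sums:
  "(\<lambda>z. ((real z - c)\<^sup>2 + 2 * N * real z) * negbin a z) sums ((real a - c)\<^sup>2 + 2 * (N + 1) * real a)"
proof -
  have "(\<lambda>z. (real z)\<^sup>2 * negbin a z + (2 * N - 2 * c) * (real z * negbin a z) + c\<^sup>2 * negbin a z)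
      sums (((real a)\<^sup>2 + 2 * real a) + (2 * N - 2 * c) * real a + c\<^sup>2 * 1)"
    by (intro sums_add sums_mult negbin_second_moment_sums negbin_mean_sums negbin_sums_1)
  then show ?thesis by (simp add: power2_eq_square algebra_simps)
qed

text \<open>
By telescoping, the left-hand side is the integral of \<open>z - a\<close> over the tail \<open>z > m\<close>.  The lemma thus
says that a chain started from \<open>a\<close> which jumps above \<open>m\<close> lands on average at most \<open>\<kappa> + 1\<close> above it,
where \<open>\<kappa>\<close> can be chosen of the order of one standard deviation.
\<close>

lemma negbin_tail_lower_bound:
  assumes \<kappa>: "\<kappa> \<ge> 1" "\<kappa>\<^sup>2 \<ge> 2 * real a" and m: "a \<le> m"
  shows "2 * real (Suc m) * negbin a (Suc m) \<le> (real (Suc m) - real a + \<kappa>) * (1 - (\<Sum>z\<le>m. negbin a z))"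
proof -
  \<comment> \<open>If the ratio of successive terms were constant, the tail would be an explicit multiple of its
    first term; \<open>g\<close> is a subsolution of the same recursion, with \<open>\<kappa>\<close> absorbing the variation
    of the ratio.\<close>
  define g where "g z = 2 * real z / (real z - real a + \<kappa>) * negbin a z" for z
  have step: "g z - g (Suc z) \<le> negbin a z" if "z \<ge> a" for z
  proof -
    define w where "w = real z - real a"
    have w: "w \<ge> 0" "real a = real z - w" using that by (auto simp: w_def)
    have "2 * real z * (w + 1 + \<kappa>) \<le> (2 * real z - w + w + 1 + \<kappa>) * (w + \<kappa>)"
    proof -
      have "2 * (real a + w) \<le> (1 + \<kappa>) * (w + \<kappa>)"
      proof -
        have "2 * w \<le> (1 + \<kappa>) * w" using \<kappa> w by (intro mult_right_mono) auto
        moreover have "2 * real a \<le> (1 + \<kappa>) * \<kappa>" using \<kappa> by (simp add: power2_eq_square algebra_simps)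
        ultimately show ?thesis by (simp add: algebra_simps)
      qed
      then show ?thesis using w by (simp add: algebra_simps)
    qed
    then have "2 * real z / (w + \<kappa>) \<le> 1 + (2 * real z - w) / (w + 1 + \<kappa>)"
      using w \<kappa> by (simp add: field_simps)
    then have le: "2 * real z / (w + \<kappa>) * negbin a z \<le> (1 + (2 * real z - w) / (w + 1 + \<kappa>)) * negbin a z"
      by (intro mult_right_mono) auto
    have "g (Suc z) = (2 * (real z + 1) * negbin a (Suc z)) / (w + 1 + \<kappa>)"
      by (simp add: g_def w_def algebra_simps)
    also have "\<dots> = (2 * real z - w) / (w + 1 + \<kappa>) * negbin a z"
      unfolding negbin_Suc by (simp add: w)
    finally have "g (Suc z) = (2 * real z - w) / (w + 1 + \<kappa>) * negbin a z" .
    moreover have "g z = 2 * real z / (w + \<kappa>) * negbin a z" by (simp add: g_def w_def)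
    ultimately show ?thesis using le unfolding distrib_right by linarith
  qed
  have "g \<longlonglongrightarrow> 0"
  proof (rule tendsto_sandwich[OF _ _ tendsto_const tendsto_mult_right_zero[OF negbin_linear_tendsto_0[of a]]])
    have "0 \<le> g n \<and> g n \<le> 2 * ((real n + 1) * negbin a n)" if "n \<ge> a" for n
    proof -
      have "2 * real n / (real n - real a + \<kappa>) \<le> 2 * real n / 1"
        using that \<kappa> by (intro divide_left_mono) auto
      then have "2 * real n / (real n - real a + \<kappa>) * negbin a n \<le> 2 * (real n + 1) * negbin a n"
        by (intro mult_right_mono) auto
      moreover have "g n \<ge> 0" using that \<kappa> by (auto simp: g_def)
      ultimately show ?thesis unfolding g_def mult.assoc by simp
    qed
    then show "\<forall>\<^sub>F n in sequentially. 0 \<le> g n" "\<forall>\<^sub>F n in sequentially. g n \<le> 2 * ((real n + 1) * negbin a n)"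
      by (auto simp: eventually_sequentially)
  qed
  then have "(\<lambda>n. g (n + Suc m)) \<longlonglongrightarrow> 0" by (rule LIMSEQ_ignore_initial_segment)
  then have "(\<lambda>n. g (n + Suc m) - g (Suc n + Suc m)) sums (g (0 + Suc m) - 0)"
    by (rule telescope_sums')
  moreover have "(\<lambda>n. negbin a (n + Suc m)) sums (1 - (\<Sum>z<Suc m. negbin a z))"
    by (rule sums_split_initial_segment[OF negbin_sums_1])
  moreover have "g (n + Suc m) - g (Suc n + Suc m) \<le> negbin a (n + Suc m)" for n
    using step[of "n + Suc m"] m by simp
  ultimately have "g (0 + Suc m) - 0 \<le> 1 - (\<Sum>z<Suc m. negbin a z)"
    by (metis (lifting) sums_le)
  then have "g (Suc m) \<le> 1 - (\<Sum>z\<le>m. negbin a z)"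
    by (simp only: lessThan_Suc_atMost) simp
  then show ?thesis
    using m \<kappa> by (simp add: g_def field_simps)
qed

text \<open>
Without truncation, the function \<open>1 - z / M\<close> is harmonic.  Killing the chain above \<open>m\<close> removes
terms whose total is nonnegative, since the mean overshoot is at most \<open>\<kappa> + 1\<close>.
\<close>

lemma negbin_truncated_superharmonic:
  assumes \<kappa>: "\<kappa> \<ge> 1" "\<kappa>\<^sup>2 \<ge> 2 * real a" and m: "a \<le> m" and M: "M = real m + 1 + \<kappa>"
  shows "(\<Sum>z\<le>m. negbin a z * (1 - real z / M)) \<le> 1 - real a / M"
proof -
  define F where "F = (\<Sum>z\<le>m. negbin a z)"
  have M0: "M > 0" using \<kappa> M by simp
  have "(\<Sum>z\<le>m. negbin a z * (M - real z))
      = (\<Sum>z\<le>m. (M - real a) * negbin a z + (real a - real z) * negbin a z)"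
    by (intro sum.cong) (auto simp: algebra_simps)
  also have "\<dots> = (M - real a) * F + 2 * real (Suc m) * negbin a (Suc m)"
    using sum_negbin_first_moment[of a "Suc m"]
    by (simp add: sum.distrib F_def sum_distrib_left lessThan_Suc_atMost)
  also have "\<dots> \<le> (M - real a) * F + (M - real a) * (1 - F)"
    using negbin_tail_lower_bound[OF \<kappa> m] unfolding M F_def by (simp add: algebra_simps)
  also have "\<dots> = M - real a" by (simp add: algebra_simps)
  finally have "(\<Sum>z\<le>m. negbin a z * (M - real z)) / M \<le> (M - real a) / M"
    using M0 by (intro divide_right_mono) auto
  then show ?thesis
    using M0 by (simp add: sum_divide_distrib diff_divide_distrib right_diff_distrib)
qed

section \<open>The critical geometric branching process\<close>

definition up_count :: "(nat \<Rightarrow> bool) \<Rightarrow> nat \<Rightarrow> nat" where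
  "up_count b n = card {i. i < n \<and> b i}"

text \<open>
The stack \<open>b\<close> shows \<open>z\<close> up bits before its \<open>a\<close>-th down bit.  A relation is used because a stack
may contain fewer than \<open>a\<close> down bits; this also makes it an event of the first \<open>a + z\<close> bits.
\<close>

definition ups_before :: "(nat \<Rightarrow> bool) \<Rightarrow> nat \<Rightarrow> nat \<Rightarrow> bool" where
  "ups_before b a z \<longleftrightarrow> (if a = 0 then z = 0 else \<not> b (a + z - 1) \<and> up_count b (a + z) = z)"

lemma up_count_0 [simp]: "up_count b 0 = 0"
  by (simp add: up_count_def)

lemma up_count_Suc: "up_count b (Suc n) = up_count b n + of_bool (b n)"
proof -
  have "{i. i < Suc n \<and> b i} = (if b n then insert n {i. i < n \<and> b i} else {i. i < n \<and> b i})"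
    by (auto simp: less_Suc_eq)
  then show ?thesis by (simp add: up_count_def)
qed

lemma up_count_mono: "m \<le> n \<Longrightarrow> up_count b m \<le> up_count b n"
  unfolding up_count_def by (intro card_mono) auto

lemma up_count_le: "up_count b n \<le> n"
  by (induction n) (auto simp: up_count_Suc)

lemma up_count_add_down_count: "up_count b n + up_count (\<lambda>i. \<not> b i) n = n"
  by (induction n) (auto simp: up_count_Suc)

lemma up_count_cong: "(\<And>i. i < n \<Longrightarrow> f i = g i) \<Longrightarrow> up_count f n = up_count g n"
  unfolding up_count_def by (metis (mono_tags, lifting))

lemma ups_before_unique:
  assumes "ups_before b a z" "ups_before b a z'"
  shows "z = z'"
proof -
  have aux: "\<not> z < z'" if z: "ups_before b a z" and z': "ups_before b a z'" for z z'
  proof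
    assume less: "z < z'"
    with z' have a: "a > 0" by (auto simp: ups_before_def split: if_splits)
    let ?d = "up_count (\<lambda>i. \<not> b i)"
    have "?d (a + z) = a" "?d (a + z') = a" "\<not> b (a + z' - 1)"
      using z z' a up_count_add_down_count[of b "a + z"] up_count_add_down_count[of b "a + z'"]
      by (auto simp: ups_before_def)
    moreover have "?d (Suc (a + z' - 1)) = ?d (a + z' - 1) + 1"
      unfolding up_count_Suc using z' a by (simp add: ups_before_def)
    moreover have "?d (a + z) \<le> ?d (a + z' - 1)" using less by (intro up_count_mono) auto
    moreover have "Suc (a + z' - 1) = a + z'" using a by simp
    ultimately show False by simp
  qed
  show ?thesis using aux[OF assms] aux[OF assms(2,1)] by linarith
qed

lemma depends_on_up_count: "depends_on (\<lambda>b. up_count b n = a) {..<n}"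
proof (rule depends_onI)
  fix f g :: "nat \<Rightarrow> bool" assume "\<And>i. i \<in> {..<n} \<Longrightarrow> f i = g i" "up_count f n = a"
  then show "up_count g n = a" using up_count_cong[of n f g] by simp
qed

lemma depends_on_ups_before: "depends_on (\<lambda>b. ups_before b a z) {..<a + z}"
proof (rule depends_onI)
  fix f g :: "nat \<Rightarrow> bool" assume *: "\<And>i. i \<in> {..<a + z} \<Longrightarrow> f i = g i" and "ups_before f a z"
  then show "ups_before g a z"
    using up_count_cong[of "a + z" f g] *[of "a + z - 1"] by (auto simp: ups_before_def split: if_splits)
qed

lemma up_count_mem: "A \<subseteq> {..<n} \<Longrightarrow> up_count (\<lambda>i. i \<in> A) n = card A"
  unfolding up_count_def by (intro arg_cong[where f = card]) auto

lemma prob_up_count: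
  assumes "fair_bits M \<eta>"
  shows "bit_prob M \<eta> (\<lambda>b. up_count b n = a) = real (n choose a) / 2 ^ n"
proof -
  have "{A. A \<subseteq> {..<n} \<and> up_count (\<lambda>i. i \<in> A) n = a} = {A. A \<subseteq> {..<n} \<and> card A = a}"
    using up_count_mem by auto
  then show ?thesis
    by (simp add: bit_prob_eq_count[OF fair_bits_fair_on[OF assms] depends_on_up_count] n_subsets)
qed

lemma prob_ups_before:
  assumes "fair_bits M \<eta>"
  shows "bit_prob M \<eta> (\<lambda>b. ups_before b a z) = negbin a z"
proof (cases "a = 0")
  case True
  then show ?thesis using assms by (cases z) (simp_all add: ups_before_def bit_prob_const negbin_def)
next
  case False
  have "{A. A \<subseteq> {..<a + z} \<and> ups_before (\<lambda>i. i \<in> A) a z} = {A. A \<subseteq> {..<a + z - 1} \<and> card A = z}"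
    (is "?L = ?R")
  proof (intro set_eqI iffI)
    fix A assume A: "A \<in> ?L"
    then have "A \<subseteq> {..<a + z}" "a + z - 1 \<notin> A" "card A = z"
      using False by (auto simp: ups_before_def up_count_mem)
    moreover from this have "i < a + z - 1" if "i \<in> A" for i
      using that by (metis lessThan_iff less_antisym subsetD Suc_diff_1 add_gr_0 False neq0_conv)
    ultimately show "A \<in> ?R" by auto
  next
    fix A assume A: "A \<in> ?R"
    then have "A \<subseteq> {..<a + z}" "a + z - 1 \<notin> A" by fastforce+
    then show "A \<in> ?L" using A False by (auto simp: ups_before_def up_count_mem)
  qed
  then show ?thesis
    by (simp add: bit_prob_eq_count[OF fair_bits_fair_on[OF assms] depends_on_ups_before] n_subsets negbin_def)
qed

text \<open>
Started from \<open>a\<close>, the branching process whose generation \<open>y + 1\<close> is read off stack \<open>y\<close> exists and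
stays at most \<open>m\<close> through generation \<open>N\<close>, and its last value satisfies \<open>P\<close>.  Taking \<open>P\<close> to be
equality with \<open>0\<close> describes extinction, taking it to be true a mere bound.
\<close>

fun stays_below :: "nat \<Rightarrow> (nat \<Rightarrow> bool) \<Rightarrow> nat \<Rightarrow> (nat \<times> nat \<Rightarrow> bool) \<Rightarrow> nat \<Rightarrow> bool" where
  "stays_below m P 0 g a \<longleftrightarrow> a \<le> m \<and> P a"
| "stays_below m P (Suc N) g a \<longleftrightarrow> a \<le> m \<and>
     (\<exists>z. ups_before (\<lambda>i. g (0, i)) a z \<and> stays_below m P N (\<lambda>(y, i). g (Suc y, i)) z)"

lemma stays_below_le: "stays_below m P N g a \<Longrightarrow> a \<le> m"
  by (cases N) auto

lemma depends_on_stays_below: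
  "depends_on (\<lambda>g. stays_below m P N g a) ({..<N} \<times> {..<2 * m})"
proof (induction N arbitrary: a)
  case 0
  then show ?case by (intro depends_onI) auto
next
  case (Suc N)
  show ?case
  proof (rule depends_onI)
    fix f g :: "nat \<times> nat \<Rightarrow> bool"
    assume fg: "\<And>p. p \<in> {..<Suc N} \<times> {..<2 * m} \<Longrightarrow> f p = g p"
    assume "stays_below m P (Suc N) f a"
    then obtain z where z: "a \<le> m" "ups_before (\<lambda>i. f (0, i)) a z"
      "stays_below m P N (\<lambda>(y, i). f (Suc y, i)) z" by auto
    have "a + z \<le> 2 * m" using z(1) stays_below_le[OF z(3)] by simp
    then have "ups_before (\<lambda>i. g (0, i)) a z"
      using z(2) depends_onD[OF depends_on_ups_before[of a z], of "\<lambda>i. f (0, i)" "\<lambda>i. g (0, i)"] fg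
      by auto
    moreover have "stays_below m P N (\<lambda>(y, i). g (Suc y, i)) z"
      using z(3) depends_onD[OF Suc.IH[of z], of "\<lambda>(y, i). f (Suc y, i)" "\<lambda>(y, i). g (Suc y, i)"] fg
      by auto
    ultimately show "stays_below m P (Suc N) g a" using z(1) by auto
  qed
qed

lemma fair_bits_row: "fair_bits M \<eta> \<Longrightarrow> fair_bits M (\<lambda>i. \<eta> (x, i))"
  by (rule fair_bits_reindex) (auto simp: inj_def)

lemma fair_bits_shift: "fair_bits M \<eta> \<Longrightarrow> fair_bits M (\<lambda>(y, i). \<eta> (Suc y, i))"
  using fair_bits_reindex[of M \<eta> "\<lambda>(y, i). (Suc y, i)"] by (auto simp: inj_def case_prod_unfold)

text \<open>
The Markov property: the first generation uses the stack \<open>0\<close>, all later ones the remaining stacks.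
\<close>

lemma prob_stays_below_Suc:
  assumes f: "fair_bits M \<eta>" and a: "a \<le> m"
  shows "bit_prob M \<eta> (\<lambda>g. stays_below m P (Suc N) g a) =
    (\<Sum>z\<le>m. negbin a z * bit_prob M (\<lambda>(y, i). \<eta> (Suc y, i)) (\<lambda>g. stays_below m P N g z))"
proof -
  let ?U = "\<lambda>z g. ups_before (\<lambda>i. g (0, i)) a z"
  let ?S = "\<lambda>z g. stays_below m P N (\<lambda>(y, i). g (Suc y, i)) z"
  let ?K = "\<lambda>z. (\<lambda>i. (0::nat, i)) ` {..<a + z}"
  let ?L = "(\<lambda>(y, i). (Suc y, i)) ` ({..<N} \<times> {..<2 * m})"
  have dU: "depends_on (?U z) (?K z)" for z
    by (rule depends_on_reindex[OF depends_on_ups_before])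
  have dS: "depends_on (?S z) ?L" for z
    using depends_on_reindex[OF depends_on_stays_below[of m P N z], of "\<lambda>(y, i). (Suc y, i)"]
    by (simp add: case_prod_unfold)
  have "bit_prob M \<eta> (\<lambda>g. stays_below m P (Suc N) g a) = bit_prob M \<eta> (\<lambda>g. \<exists>z\<in>{..m}. ?U z g \<and> ?S z g)"
    using a by (intro arg_cong[where f = "bit_prob M \<eta>"] ext) (auto dest: stays_below_le)
  also have "\<dots> = (\<Sum>z\<in>{..m}. bit_prob M \<eta> (\<lambda>g. ?U z g \<and> ?S z g))"
    by (rule bit_prob_disjoint_Ex[OF f, where K = "\<lambda>z. ?K z \<union> ?L"])
      (auto intro!: depends_on_conj dU dS dest: ups_before_unique)
  also have "\<dots> = (\<Sum>z\<in>{..m}. bit_prob M \<eta> (?U z) * bit_prob M \<eta> (?S z))"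
    by (intro sum.cong bit_prob_indep[OF f _ _ _ dU dS]) auto
  also have "\<dots> = (\<Sum>z\<in>{..m}. negbin a z * bit_prob M (\<lambda>(y, i). \<eta> (Suc y, i)) (\<lambda>g. stays_below m P N g z))"
  proof (intro sum.cong refl arg_cong2[where f = "(*)"])
    show "bit_prob M \<eta> (?U z) = negbin a z" for z
      using prob_ups_before[OF fair_bits_row[OF f], of 0 a z] by (simp add: bit_prob_def)
    show "bit_prob M \<eta> (?S z) = bit_prob M (\<lambda>(y, i). \<eta> (Suc y, i)) (\<lambda>g. stays_below m P N g z)" for z
      by (simp add: bit_prob_def case_prod_unfold)
  qed
  finally show ?thesis .
qed

text \<open>
A nonnegative function that is superharmonic for the killed chain and equals \<open>1\<close> at extinction
dominates the probability of extinction without exceeding \<open>m\<close>.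
\<close>

lemma prob_extinct_below_le:
  assumes f: "fair_bits M \<eta>" and \<kappa>: "\<kappa> \<ge> 1" "\<kappa>\<^sup>2 \<ge> 2 * real m" and M: "\<mu> = real m + 1 + \<kappa>"
    and a: "a \<le> m"
  shows "bit_prob M \<eta> (\<lambda>g. stays_below m (\<lambda>z. z = 0) N g a) \<le> 1 - real a / \<mu>"
  using f a
proof (induction N arbitrary: \<eta> a)
  case 0
  show ?case
  proof (cases "a = 0")
    case True
    then show ?thesis using bit_prob_le_1[OF 0(1)] by simp
  next
    case False
    then show ?thesis using 0 \<kappa> by (simp add: bit_prob_const M)
  qed
next
  case (Suc N)
  have "bit_prob M \<eta> (\<lambda>g. stays_below m (\<lambda>z. z = 0) (Suc N) g a)
      \<le> (\<Sum>z\<le>m. negbin a z * (1 - real z / \<mu>))"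
    unfolding prob_stays_below_Suc[OF Suc.prems]
    by (intro sum_mono mult_left_mono Suc.IH fair_bits_shift Suc.prems) auto
  also have "\<dots> \<le> 1 - real a / \<mu>"
  proof (rule negbin_truncated_superharmonic)
    show "2 * real a \<le> \<kappa>\<^sup>2" using \<kappa> Suc.prems by linarith
  qed (use \<kappa> M Suc.prems in auto)
  finally show ?case .
qed

text \<open>
Doob's maximal inequality for the second moment around a centre \<open>c\<close> below \<open>m\<close>, proved by
comparing the probability with the quadratic martingale.
\<close>

lemma prob_not_stays_below_le:
  assumes f: "fair_bits M \<eta>" and c: "c < real m"
  shows "1 - bit_prob M \<eta> (\<lambda>g. stays_below m (\<lambda>_. True) N g a)
    \<le> ((real a - c)\<^sup>2 + 2 * real N * real a) / (real m - c)\<^sup>2"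
  using f
proof (induction N arbitrary: \<eta> a)
  \<comment> \<open>Above the level \<open>m\<close> the bound is at least \<open>1\<close>, so the terms dropped by truncating at \<open>m\<close> are
    nonpositive.\<close>
  have big: "1 \<le> ((real a - c)\<^sup>2 + 2 * real N * real a) / (real m - c)\<^sup>2" if "a > m" for a N
  proof -
    have "(real m - c)\<^sup>2 \<le> (real a - c)\<^sup>2" using that c by (intro power_mono) auto
    then show ?thesis using c by (simp add: add_increasing2)
  qed
  {
    case 0
    show ?case
    proof (cases "a \<le> m")
      case True
      then show ?thesis using bit_prob_const[OF 0] by simp
    next
      case False
      then show ?thesis using big[of a 0] bit_prob_const[OF 0, of False] by simp
    qed
  next
    case (Suc N)
    let ?\<phi> = "\<lambda>z. ((real z - c)\<^sup>2 + 2 * real N * real z) / (real m - c)\<^sup>2"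
    show ?case
    proof (cases "a \<le> m")
      case True
      have "(\<lambda>z. negbin a z - ((real z - c)\<^sup>2 + 2 * real N * real z) * negbin a z / (real m - c)\<^sup>2) sums
          (1 - ((real a - c)\<^sup>2 + 2 * (real N + 1) * real a) / (real m - c)\<^sup>2)"
        by (intro sums_diff sums_divide negbin_sums_1 negbin_quadratic_sums)
      then have "(\<lambda>z. negbin a z * (1 - ?\<phi> z)) sums
          (1 - ((real a - c)\<^sup>2 + 2 * real (Suc N) * real a) / (real m - c)\<^sup>2)"
        by (simp add: algebra_simps)
      moreover have "(\<lambda>z. if z \<in> {..m} then negbin a z * (1 - ?\<phi> z) else 0) sums
          (\<Sum>z\<in>{..m}. negbin a z * (1 - ?\<phi> z))"
        by (rule sums_If_finite_set) simp
      moreover have "negbin a z * (1 - ?\<phi> z) \<le> (if z \<in> {..m} then negbin a z * (1 - ?\<phi> z) else 0)" for z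
        using big[of z N] by (auto intro: mult_nonneg_nonpos)
      ultimately have "1 - ((real a - c)\<^sup>2 + 2 * real (Suc N) * real a) / (real m - c)\<^sup>2
          \<le> (\<Sum>z\<in>{..m}. negbin a z * (1 - ?\<phi> z))"
        by (rule sums_le[rotated])
      also have "\<dots> \<le> bit_prob M \<eta> (\<lambda>g. stays_below m (\<lambda>_. True) (Suc N) g a)"
        unfolding prob_stays_below_Suc[OF Suc.prems True]
      proof (intro sum_mono mult_left_mono)
        show "1 - ?\<phi> z \<le> bit_prob M (\<lambda>(y, i). \<eta> (Suc y, i)) (\<lambda>g. stays_below m (\<lambda>_. True) N g z)" for z
          using Suc.IH[OF fair_bits_shift[OF Suc.prems], of z] by linarith
      qed simp
      finally show ?thesis by linarith
    next
      case False
      then show ?thesis using big[of a "Suc N"] bit_prob_const[OF Suc.prems, of False] by simp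
    qed
  }
qed

section \<open>Two branching processes from one stack\<close>

lemma sum_binomial_Suc:
  fixes h :: "nat \<Rightarrow> real"
  shows "(\<Sum>a\<le>Suc r. real (Suc r choose a) * h a) = (\<Sum>a\<le>r. real (r choose a) * (h a + h (Suc a)))"
proof -
  have "(\<Sum>a\<le>Suc r. real (Suc r choose a) * h a)
      = h 0 + (\<Sum>a\<le>r. real (r choose Suc a) * h (Suc a)) + (\<Sum>a\<le>r. real (r choose a) * h (Suc a))"
    by (subst sum.atMost_Suc_shift) (simp add: algebra_simps sum.distrib)
  also have "h 0 + (\<Sum>a\<le>r. real (r choose Suc a) * h (Suc a)) = (\<Sum>a\<le>Suc r. real (r choose a) * h a)"
    by (subst sum.atMost_Suc_shift) simp
  also have "\<dots> = (\<Sum>a\<le>r. real (r choose a) * h a)" by simp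
  finally show ?thesis by (simp add: algebra_simps sum.distrib)
qed

text \<open>
The shift \<open>x\<close> is what makes the induction on \<open>r\<close> go through; \<open>x = 0\<close> is the variance of a fair
binomial variable.
\<close>

lemma sum_binomial_square:
  "(\<Sum>a\<le>r. real (r choose a) * (real a - real r / 2 + x)\<^sup>2) = 2 ^ r * (real r / 4 + x\<^sup>2)"
proof (induction r arbitrary: x)
  case (Suc r)
  have "(\<Sum>a\<le>Suc r. real (Suc r choose a) * (real a - real (Suc r) / 2 + x)\<^sup>2)
    = (\<Sum>a\<le>r. real (r choose a) * (real a - real r / 2 + (x - 1/2))\<^sup>2
              + real (r choose a) * (real a - real r / 2 + (x + 1/2))\<^sup>2)"
  proof (subst sum_binomial_Suc, intro sum.cong refl)
    fix a
    have "real a - real (Suc r) / 2 + x = real a - real r / 2 + (x - 1/2)"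
      "real (Suc a) - real (Suc r) / 2 + x = real a - real r / 2 + (x + 1/2)"
      by (simp_all add: field_simps)
    then show "real (r choose a) * ((real a - real (Suc r) / 2 + x)\<^sup>2 + (real (Suc a) - real (Suc r) / 2 + x)\<^sup>2)
      = real (r choose a) * (real a - real r / 2 + (x - 1/2))\<^sup>2
              + real (r choose a) * (real a - real r / 2 + (x + 1/2))\<^sup>2"
      by (simp only: distrib_left)
  qed
  also have "\<dots> = 2 ^ r * (real r / 4 + (x - 1/2)\<^sup>2) + 2 ^ r * (real r / 4 + (x + 1/2)\<^sup>2)"
    by (simp add: sum.distrib Suc.IH)
  also have "\<dots> = 2 ^ Suc r * (real (Suc r) / 4 + x\<^sup>2)"
    by (simp add: power2_eq_square field_simps)
  finally show ?case .
qed auto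

lemma sum_binomial_linear: "(\<Sum>a\<le>r. real (r choose a) * real a) = 2 ^ r * (real r / 2)"
proof -
  have "(\<Sum>a\<le>r. real a * real (r choose a)) = real (\<Sum>a\<le>r. a * (r choose a))" by simp
  also have "\<dots> = real r * 2 ^ (r - 1)" unfolding choose_linear_sum by simp
  also have "\<dots> = 2 ^ r * (real r / 2)" by (cases r) auto
  finally show ?thesis by (simp add: mult.commute)
qed

text \<open>
Row \<open>y\<close> is the stack of the vertex \<open>1 + y\<close>, whose up steps cross the edge \<open>y + 2\<close>.
\<close>

definition right_stacks :: "(int \<times> nat \<Rightarrow> bool) \<Rightarrow> nat \<times> nat \<Rightarrow> bool" where
  "right_stacks f = (\<lambda>(y, i). f (1 + int y, i))"

text \<open>
The stacks of the reflected walk: the left half-line of \<open>f\<close> is the right half-line of its mirror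
image, so only the right side needs to be analysed.
\<close>

definition mirror_stacks :: "(int \<times> nat \<Rightarrow> bool) \<Rightarrow> int \<times> nat \<Rightarrow> bool" where
  "mirror_stacks f = (\<lambda>(x, i). \<not> f (- x, i))"

definition right_start :: "(int \<times> nat \<Rightarrow> bool) \<Rightarrow> nat \<Rightarrow> nat" where
  "right_start f r = up_count (\<lambda>i. f (0, i)) r"

text \<open>
If the walk uses exactly \<open>r\<close> bits at the origin and returns, neither half-line contains an edge that
is crossed outwards more than \<open>m\<close> times, and both branching processes are extinct in
generation \<open>N\<close>.
\<close>

definition both_sides_small :: "nat \<Rightarrow> nat \<Rightarrow> nat \<Rightarrow> (int \<times> nat \<Rightarrow> bool) \<Rightarrow> bool" where
  "both_sides_small r m N f \<longleftrightarrow>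
     stays_below m (\<lambda>z. z = 0) N (right_stacks f) (right_start f r) \<and>
     stays_below m (\<lambda>z. z = 0) N (right_stacks (mirror_stacks f)) (right_start (mirror_stacks f) r)"

text \<open>
Some of the first \<open>N + 1\<close> edges on the right would be crossed upwards more than \<open>m\<close> times, or a
stack has too few down bits for the walk to come back.
\<close>

definition right_overshoot :: "nat \<Rightarrow> nat \<Rightarrow> nat \<Rightarrow> (int \<times> nat \<Rightarrow> bool) \<Rightarrow> bool" where
  "right_overshoot r m N f \<longleftrightarrow> \<not> stays_below m (\<lambda>_. True) N (right_stacks f) (right_start f r)"

lemma fair_bits_right_stacks:
  fixes \<eta> :: "int \<times> nat \<Rightarrow> 'a \<Rightarrow> bool"
  shows "fair_bits M \<eta> \<Longrightarrow> fair_bits M (\<lambda>p \<omega>. right_stacks (\<lambda>i. \<eta> i \<omega>) p)"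
  using fair_bits_reindex[of M \<eta> "\<lambda>(y, i). (1 + int y, i)"]
  by (auto simp: inj_def case_prod_unfold right_stacks_def)

lemma fair_bits_mirror:
  fixes \<eta> :: "int \<times> nat \<Rightarrow> 'a \<Rightarrow> bool"
  shows "fair_bits M \<eta> \<Longrightarrow> fair_bits M (\<lambda>p \<omega>. mirror_stacks (\<lambda>i. \<eta> i \<omega>) p)"
  using fair_bits_not[OF fair_bits_reindex[of M \<eta> "\<lambda>(x, i). (- x, i)"]]
  by (auto simp: inj_def case_prod_unfold mirror_stacks_def)

lemma right_start_mirror: "right_start (mirror_stacks f) r = r - right_start f r"
  using up_count_add_down_count[of "\<lambda>i. f (0, i)" r]
  by (simp add: right_start_def mirror_stacks_def)

lemma right_start_le: "right_start f r \<le> r"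
  by (simp add: right_start_def up_count_le)

lemma depends_on_right_start:
  "depends_on (\<lambda>f. right_start f r = a) ((\<lambda>i. (0, i)) ` {..<r})"
  unfolding right_start_def by (rule depends_on_reindex[OF depends_on_up_count])

lemma prob_right_start:
  "fair_bits M \<eta> \<Longrightarrow> bit_prob M \<eta> (\<lambda>f. right_start f r = a) = real (r choose a) / 2 ^ r"
  using prob_up_count[OF fair_bits_row[of M \<eta> 0], of r a]
  by (simp add: bit_prob_def right_start_def)

lemma depends_on_right_chain:
  "depends_on (\<lambda>f. stays_below m P N (right_stacks f) a)
     ((\<lambda>(y, i). (1 + int y, i)) ` ({..<N} \<times> {..<2 * m}))"
  using depends_on_reindex[OF depends_on_stays_below[of m P N a], of "\<lambda>(y, i). (1 + int y, i)"]
  by (simp add: case_prod_unfold right_stacks_def)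

lemma depends_on_left_chain:
  "depends_on (\<lambda>f. stays_below m P N (right_stacks (mirror_stacks f)) a)
     ((\<lambda>(y, i). (- 1 - int y, i)) ` ({..<N} \<times> {..<2 * m}))"
proof (rule depends_onI)
  fix f g :: "int \<times> nat \<Rightarrow> bool"
  assume fg: "\<And>p. p \<in> (\<lambda>(y, i). (- 1 - int y, i)) ` ({..<N} \<times> {..<2 * m}) \<Longrightarrow> f p = g p"
    and s: "stays_below m P N (right_stacks (mirror_stacks f)) a"
  have "right_stacks (mirror_stacks f) p = right_stacks (mirror_stacks g) p" if "p \<in> {..<N} \<times> {..<2 * m}" for p
    using that fg[of "(- 1 - int (fst p), snd p)"]
    by (force simp: right_stacks_def mirror_stacks_def case_prod_unfold)
  then have "stays_below m P N (right_stacks (mirror_stacks f)) a = stays_below m P N (right_stacks (mirror_stacks g)) a"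
    by (rule depends_onD[OF depends_on_stays_below])
  with s show "stays_below m P N (right_stacks (mirror_stacks g)) a" by simp
qed

lemma depends_on_both_sides_small: "\<exists>K. finite K \<and> depends_on (both_sides_small r m N) K"
proof -
  have *: "both_sides_small r m N = (\<lambda>f. \<exists>a\<in>{..r}. right_start f r = a \<and>
      (stays_below m (\<lambda>z. z = 0) N (right_stacks f) a \<and>
       stays_below m (\<lambda>z. z = 0) N (right_stacks (mirror_stacks f)) (r - a)))"
    unfolding both_sides_small_def right_start_mirror using right_start_le by auto
  let ?K = "\<Union>a\<in>{..r}. (\<lambda>i. (0, i)) ` {..<r} \<union>
    ((\<lambda>(y, i). (1 + int y, i)) ` ({..<N} \<times> {..<2 * m}) \<union> (\<lambda>(y, i). (- 1 - int y, i)) ` ({..<N} \<times> {..<2 * m}))"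
  have "depends_on (both_sides_small r m N) ?K"
    unfolding * by (intro depends_on_Bex depends_on_conj depends_on_right_start depends_on_right_chain
        depends_on_left_chain)
  moreover have "finite ?K" by simp
  ultimately show ?thesis by blast
qed

text \<open>
Conditionally on \<open>a\<close> up bits among the first \<open>r\<close> at the origin the two sides are independent, and
\<open>(1 - a / \<mu>) * (1 - (r - a) / \<mu>)\<close> is largest for \<open>a = r / 2\<close>.  The exponent \<open>2\<close> is decisive: a
single side would give errors that are not summable over the grid of values \<open>r\<close>.
\<close>

lemma prob_both_sides_small:
  assumes f: "fair_bits M \<eta>" and \<kappa>: "\<kappa> \<ge> 1" "\<kappa>\<^sup>2 \<ge> 2 * real m" and \<mu>: "\<mu> = real m + 1 + \<kappa>"
  shows "bit_prob M \<eta> (both_sides_small r m N) \<le> (1 - real r / (2 * \<mu>))\<^sup>2"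
proof -
  let ?R = "\<lambda>a f. stays_below m (\<lambda>z. z = 0) N (right_stacks f) a"
  let ?L = "\<lambda>a f. stays_below m (\<lambda>z. z = 0) N (right_stacks (mirror_stacks f)) (r - a)"
  let ?K0 = "(\<lambda>i. (0::int, i)) ` {..<r}"
  let ?KR = "(\<lambda>(y, i). (1 + int y, i)) ` ({..<N} \<times> {..<2 * m})"
  let ?KL = "(\<lambda>(y, i). (- 1 - int y, i)) ` ({..<N} \<times> {..<2 * m})"
  have eq: "both_sides_small r m N = (\<lambda>f. \<exists>a\<in>{..r}. right_start f r = a \<and> (?R a f \<and> ?L a f))"
    unfolding both_sides_small_def right_start_mirror using right_start_le by auto
  have "bit_prob M \<eta> (both_sides_small r m N)
      = (\<Sum>a\<le>r. bit_prob M \<eta> (\<lambda>f. right_start f r = a \<and> (?R a f \<and> ?L a f)))"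
    unfolding eq
  proof (rule bit_prob_disjoint_Ex[OF f])
    show "depends_on (\<lambda>f. right_start f r = a \<and> (?R a f \<and> ?L a f)) (?K0 \<union> (?KR \<union> ?KL))" for a
      by (intro depends_on_conj depends_on_right_start depends_on_right_chain depends_on_left_chain)
  qed simp_all
  also have "\<dots> = (\<Sum>a\<le>r. real (r choose a) / 2 ^ r * (bit_prob M \<eta> (?R a) * bit_prob M \<eta> (?L a)))"
  proof (intro sum.cong refl)
    fix a
    have "bit_prob M \<eta> (\<lambda>f. right_start f r = a \<and> (?R a f \<and> ?L a f))
        = bit_prob M \<eta> (\<lambda>f. right_start f r = a) * bit_prob M \<eta> (\<lambda>f. ?R a f \<and> ?L a f)"
      by (rule bit_prob_indep[OF f _ _ _ depends_on_right_start
            depends_on_conj[OF depends_on_right_chain depends_on_left_chain]]) auto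
    also have "bit_prob M \<eta> (\<lambda>f. ?R a f \<and> ?L a f) = bit_prob M \<eta> (?R a) * bit_prob M \<eta> (?L a)"
      by (rule bit_prob_indep[OF f _ _ _ depends_on_right_chain depends_on_left_chain]) auto
    finally show "bit_prob M \<eta> (\<lambda>f. right_start f r = a \<and> (?R a f \<and> ?L a f))
        = real (r choose a) / 2 ^ r * (bit_prob M \<eta> (?R a) * bit_prob M \<eta> (?L a))"
      by (simp add: prob_right_start[OF f])
  qed
  also have "\<dots> \<le> (\<Sum>a\<le>r. real (r choose a) / 2 ^ r * (1 - real r / (2 * \<mu>))\<^sup>2)"
  proof (intro sum_mono mult_left_mono)
    fix a assume a: "a \<in> {..r}"
    have R: "bit_prob M \<eta> (?R a) = bit_prob M (\<lambda>p \<omega>. right_stacks (\<lambda>i. \<eta> i \<omega>) p)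
        (\<lambda>g. stays_below m (\<lambda>z. z = 0) N g a)"
      by (simp add: bit_prob_def)
    have L: "bit_prob M \<eta> (?L a) = bit_prob M (\<lambda>p \<omega>. right_stacks (\<lambda>i. mirror_stacks (\<lambda>i. \<eta> i \<omega>) i) p)
        (\<lambda>g. stays_below m (\<lambda>z. z = 0) N g (r - a))"
      by (simp add: bit_prob_def)
    show "bit_prob M \<eta> (?R a) * bit_prob M \<eta> (?L a) \<le> (1 - real r / (2 * \<mu>))\<^sup>2"
    proof (cases "a \<le> m \<and> r - a \<le> m")
      case True
      have \<mu>0: "\<mu> > 0" "\<mu> > real m" using \<kappa> \<mu> by auto
      have "bit_prob M \<eta> (?R a) \<le> 1 - real a / \<mu>"
        unfolding R by (rule prob_extinct_below_le[OF fair_bits_right_stacks[OF f] \<kappa> \<mu>]) (use True in auto)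
      moreover have "bit_prob M \<eta> (?L a) \<le> 1 - real (r - a) / \<mu>"
        unfolding L by (rule prob_extinct_below_le[OF fair_bits_right_stacks[OF fair_bits_mirror[OF f]] \<kappa> \<mu>])
          (use True in auto)
      moreover have "0 \<le> 1 - real a / \<mu>" using True \<mu>0 by simp
      ultimately have "bit_prob M \<eta> (?R a) * bit_prob M \<eta> (?L a)
          \<le> (1 - real a / \<mu>) * (1 - real (r - a) / \<mu>)"
        by (intro mult_mono) auto
      also have "\<dots> \<le> (((1 - real a / \<mu>) + (1 - real (r - a) / \<mu>)) / 2)\<^sup>2"
      proof -
        have "x * y \<le> ((x + y) / 2)\<^sup>2" for x y :: real
          using sum_squares_bound[of x y] by (simp add: power2_eq_square field_simps)
        then show ?thesis .
      qed
      also have "((1 - real a / \<mu>) + (1 - real (r - a) / \<mu>)) / 2 = 1 - real r / (2 * \<mu>)"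
        using a \<mu>0 by (simp add: of_nat_diff field_simps)
      finally show ?thesis .
    next
      case False
      then consider "\<And>f. \<not> ?R a f" | "\<And>f. \<not> ?L a f"
        using stays_below_le by blast
      then have "?R a = (\<lambda>_. False) \<or> ?L a = (\<lambda>_. False)"
        by cases simp_all
      then have "bit_prob M \<eta> (?R a) = 0 \<or> bit_prob M \<eta> (?L a) = 0"
        using bit_prob_const[OF f, of False] by auto
      then show ?thesis by auto
    qed
  qed simp
  also have "\<dots> = (\<Sum>a\<le>r. real (r choose a)) / 2 ^ r * (1 - real r / (2 * \<mu>))\<^sup>2"
    by (simp add: sum_distrib_right sum_divide_distrib)
  also have "(\<Sum>a\<le>r. real (r choose a)) = 2 ^ r"
    using choose_row_sum[of r] by (metis of_nat_numeral of_nat_power of_nat_sum)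
  finally show ?thesis by simp
qed

lemma depends_on_right_overshoot: "\<exists>K. finite K \<and> depends_on (right_overshoot r m N) K"
proof -
  have *: "right_overshoot r m N = (\<lambda>f. \<exists>a\<in>{..r}. right_start f r = a \<and>
      \<not> stays_below m (\<lambda>_. True) N (right_stacks f) a)"
    unfolding right_overshoot_def using right_start_le by auto
  let ?K = "\<Union>a\<in>{..r}. (\<lambda>i. (0, i)) ` {..<r} \<union> (\<lambda>(y, i). (1 + int y, i)) ` ({..<N} \<times> {..<2 * m})"
  have "depends_on (right_overshoot r m N) ?K"
    unfolding * by (intro depends_on_Bex depends_on_conj depends_on_not depends_on_right_start depends_on_right_chain)
  moreover have "finite ?K" by simp
  ultimately show ?thesis by blast
qed

text \<open>
The maximal inequality around \<open>r / 2\<close>, averaged over the binomial number of up bits at the origin.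
\<close>

lemma prob_right_overshoot:
  assumes f: "fair_bits M \<eta>" and m: "real r / 2 < real m"
  shows "bit_prob M \<eta> (right_overshoot r m N) \<le> (1/4 + real N) * real r / (real m - real r / 2)\<^sup>2"
proof -
  let ?c = "real r / 2"
  let ?Q = "\<lambda>a f. \<not> stays_below m (\<lambda>_. True) N (right_stacks f) a"
  let ?K0 = "(\<lambda>i. (0::int, i)) ` {..<r}"
  let ?KR = "(\<lambda>(y, i). (1 + int y, i)) ` ({..<N} \<times> {..<2 * m})"
  have eq: "right_overshoot r m N = (\<lambda>f. \<exists>a\<in>{..r}. right_start f r = a \<and> ?Q a f)"
    unfolding right_overshoot_def using right_start_le by auto
  have "bit_prob M \<eta> (right_overshoot r m N) = (\<Sum>a\<le>r. bit_prob M \<eta> (\<lambda>f. right_start f r = a \<and> ?Q a f))"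
    unfolding eq
  proof (rule bit_prob_disjoint_Ex[OF f])
    show "depends_on (\<lambda>f. right_start f r = a \<and> ?Q a f) (?K0 \<union> ?KR)" for a
      by (intro depends_on_conj depends_on_not depends_on_right_start depends_on_right_chain)
  qed simp_all
  also have "\<dots> = (\<Sum>a\<le>r. real (r choose a) / 2 ^ r * bit_prob M \<eta> (?Q a))"
  proof (intro sum.cong refl)
    fix a
    have "bit_prob M \<eta> (\<lambda>f. right_start f r = a \<and> ?Q a f)
        = bit_prob M \<eta> (\<lambda>f. right_start f r = a) * bit_prob M \<eta> (?Q a)"
      by (rule bit_prob_indep[OF f _ _ _ depends_on_right_start depends_on_not[OF depends_on_right_chain]]) auto
    then show "bit_prob M \<eta> (\<lambda>f. right_start f r = a \<and> ?Q a f) = real (r choose a) / 2 ^ r * bit_prob M \<eta> (?Q a)"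
      by (simp add: prob_right_start[OF f])
  qed
  also have "\<dots> \<le> (\<Sum>a\<le>r. real (r choose a) / 2 ^ r *
      (((real a - ?c)\<^sup>2 + 2 * real N * real a) / (real m - ?c)\<^sup>2))"
  proof (intro sum_mono mult_left_mono)
    fix a
    have "bit_prob M \<eta> (?Q a) = 1 - bit_prob M \<eta> (\<lambda>f. stays_below m (\<lambda>_. True) N (right_stacks f) a)"
      by (rule bit_prob_not[OF f _ depends_on_right_chain]) simp
    also have "\<dots> = 1 - bit_prob M (\<lambda>p \<omega>. right_stacks (\<lambda>i. \<eta> i \<omega>) p) (\<lambda>g. stays_below m (\<lambda>_. True) N g a)"
      by (simp add: bit_prob_def)
    also have "\<dots> \<le> ((real a - ?c)\<^sup>2 + 2 * real N * real a) / (real m - ?c)\<^sup>2"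
      by (rule prob_not_stays_below_le[OF fair_bits_right_stacks[OF f] m])
    finally show "bit_prob M \<eta> (?Q a) \<le> ((real a - ?c)\<^sup>2 + 2 * real N * real a) / (real m - ?c)\<^sup>2" .
  qed simp
  also have "\<dots> = ((\<Sum>a\<le>r. real (r choose a) * (real a - ?c + 0)\<^sup>2)
      + 2 * real N * (\<Sum>a\<le>r. real (r choose a) * real a)) / (2 ^ r * (real m - ?c)\<^sup>2)"
    by (simp add: sum_divide_distrib sum_distrib_left sum.distrib[symmetric] algebra_simps add_divide_distrib)
  also have "\<dots> = 2 ^ r * ((1/4 + real N) * real r) / (2 ^ r * (real m - ?c)\<^sup>2)"
    unfolding sum_binomial_square sum_binomial_linear by (simp add: algebra_simps)
  finally show ?thesis by simp
qed

section \<open>Paths and their local times\<close>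

definition walk_path :: "(nat \<Rightarrow> bool) \<Rightarrow> nat \<Rightarrow> int" where
  "walk_path b n = (\<Sum>k<n. if b k then 1 else - 1)"

lemma walk_path_0 [simp]: "walk_path b 0 = 0"
  by (simp add: walk_path_def)

lemma walk_path_Suc: "walk_path b (Suc n) = walk_path b n + (if b n then 1 else - 1)"
  by (simp add: walk_path_def)

lemma crossed_edge_path: "crossed_edge (walk_path b) (Suc n) = (if b n then walk_path b n + 1 else walk_path b n)"
  by (auto simp: crossed_edge_def walk_path_Suc)

lemma walk_path_cong: "(\<And>i. i < n \<Longrightarrow> f i = g i) \<Longrightarrow> walk_path f n = walk_path g n"
  by (simp add: walk_path_def)

lemma edge_local_time_0 [simp]: "edge_local_time s x 0 = 0"
  by (simp add: edge_local_time_def)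

lemma edge_local_time_Suc:
  "edge_local_time s x (Suc n) = edge_local_time s x n + of_bool (crossed_edge s (Suc n) = x)"
proof -
  have "{j. 1 \<le> j \<and> j \<le> Suc n \<and> crossed_edge s j = x} =
     (if crossed_edge s (Suc n) = x then insert (Suc n) {j. 1 \<le> j \<and> j \<le> n \<and> crossed_edge s j = x}
      else {j. 1 \<le> j \<and> j \<le> n \<and> crossed_edge s j = x})"
    by (auto simp: le_Suc_eq)
  then show ?thesis by (simp add: edge_local_time_def)
qed

lemma edge_local_time_mono: "m \<le> n \<Longrightarrow> edge_local_time s x m \<le> edge_local_time s x n"
  by (rule lift_Suc_mono_le) (auto simp: edge_local_time_Suc)

lemma edge_local_time_cong:
  "(\<And>i. i \<le> n \<Longrightarrow> s i = t i) \<Longrightarrow> edge_local_time s x n = edge_local_time t x n"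
  unfolding edge_local_time_def crossed_edge_def by (intro arg_cong[where f = card]) auto

lemma edge_local_time_le: "edge_local_time s x n \<le> n"
proof -
  have "edge_local_time s x n \<le> card {1..n}"
    unfolding edge_local_time_def by (rule card_mono) auto
  then show ?thesis by simp
qed

lemma bdd_above_local_times: "bdd_above (range (\<lambda>y. edge_local_time s y n))"
  using edge_local_time_le by (auto intro!: bdd_aboveI)

text \<open>
From time \<open>1\<close> on the largest local time is positive, so that only edges crossed so far compete.
\<close>

lemma favorite_edges_finite_nonempty:
  assumes "1 \<le> n"
  shows "finite (favorite_edges s n)" "favorite_edges s n \<noteq> {}"
proof -
  let ?L = "\<lambda>y. edge_local_time s y n"
  have fin: "finite (range ?L)"
    by (rule finite_subset[of _ "{..n}"]) (use edge_local_time_le in auto)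
  have "(SUP y. ?L y) \<in> range ?L"
    using fin by (subst cSup_eq_Max) (auto intro: Max_in)
  then show "favorite_edges s n \<noteq> {}" by (force simp: favorite_edges_def)
  have "1 \<le> ?L (crossed_edge s 1)"
  proof -
    have "{j. 1 \<le> j \<and> j \<le> n \<and> crossed_edge s j = crossed_edge s 1} \<noteq> {}" using assms by auto
    moreover have "finite {j. 1 \<le> j \<and> j \<le> n \<and> crossed_edge s j = crossed_edge s 1}" by simp
    ultimately have "0 < ?L (crossed_edge s 1)" unfolding edge_local_time_def by (simp add: card_gt_0_iff)
    then show ?thesis by simp
  qed
  also have "\<dots> \<le> (SUP y. ?L y)" by (rule cSUP_upper[OF _ bdd_above_local_times]) simp
  finally have pos: "1 \<le> (SUP y. ?L y)" .
  have "favorite_edges s n \<subseteq> crossed_edge s ` {1..n}"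
  proof
    fix x assume "x \<in> favorite_edges s n"
    then have "0 < ?L x" using pos by (simp add: favorite_edges_def)
    then have "{j. 1 \<le> j \<and> j \<le> n \<and> crossed_edge s j = x} \<noteq> {}"
      unfolding edge_local_time_def by (metis card.empty less_irrefl)
    then show "x \<in> crossed_edge s ` {1..n}" by auto
  qed
  then show "finite (favorite_edges s n)" by (rule finite_subset) simp
qed

section \<open>The walk driven by stacks of instructions\<close>

text \<open>
The state consists of the position and of the number of bits already taken from each stack, which
is also the number of departures from the vertex.
\<close>

primrec stack_walk :: "(int \<times> nat \<Rightarrow> bool) \<Rightarrow> nat \<Rightarrow> int \<times> (int \<Rightarrow> nat)" where
  "stack_walk f 0 = (0, \<lambda>_. 0)"
| "stack_walk f (Suc n) = (let (x, c) = stack_walk f n in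
     (if f (x, c x) then x + 1 else x - 1, c(x := Suc (c x))))"

definition position :: "(int \<times> nat \<Rightarrow> bool) \<Rightarrow> nat \<Rightarrow> int" where
  "position f n = fst (stack_walk f n)"

definition visits :: "(int \<times> nat \<Rightarrow> bool) \<Rightarrow> nat \<Rightarrow> int \<Rightarrow> nat" where
  "visits f n = snd (stack_walk f n)"

definition step_bit :: "(int \<times> nat \<Rightarrow> bool) \<Rightarrow> nat \<Rightarrow> bool" where
  "step_bit f n = f (position f n, visits f n (position f n))"

definition ups :: "(int \<times> nat \<Rightarrow> bool) \<Rightarrow> nat \<Rightarrow> int \<Rightarrow> nat" where
  "ups f n x = up_count (\<lambda>i. f (x, i)) (visits f n x)"

definition downs :: "(int \<times> nat \<Rightarrow> bool) \<Rightarrow> nat \<Rightarrow> int \<Rightarrow> nat" where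
  "downs f n x = up_count (\<lambda>i. \<not> f (x, i)) (visits f n x)"

lemma position_0 [simp]: "position f 0 = 0" and visits_0 [simp]: "visits f 0 x = 0"
  by (simp_all add: position_def visits_def)

lemma position_Suc: "position f (Suc n) = position f n + (if step_bit f n then 1 else - 1)"
  by (simp add: position_def step_bit_def visits_def case_prod_unfold Let_def)

lemma visits_Suc: "visits f (Suc n) x = visits f n x + of_bool (position f n = x)"
  by (simp add: position_def visits_def case_prod_unfold Let_def)

lemma position_eq_path: "position f = walk_path (step_bit f)"
proof
  show "position f n = walk_path (step_bit f) n" for n
    by (induction n) (simp_all add: position_Suc walk_path_Suc)
qed

lemma ups_0 [simp]: "ups f 0 x = 0" and downs_0 [simp]: "downs f 0 x = 0"
  by (simp_all add: ups_def downs_def)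

lemma ups_Suc: "ups f (Suc n) x = ups f n x + of_bool (position f n = x \<and> step_bit f n)"
  by (auto simp: ups_def visits_Suc up_count_Suc step_bit_def)

lemma downs_Suc: "downs f (Suc n) x = downs f n x + of_bool (position f n = x \<and> \<not> step_bit f n)"
  by (auto simp: downs_def visits_Suc up_count_Suc step_bit_def)

lemma ups_add_downs: "ups f n x + downs f n x = visits f n x"
  by (simp add: ups_def downs_def up_count_add_down_count)

text \<open>
Edge \<open>x\<close> is crossed by an up step from \<open>x - 1\<close> or by a down step from \<open>x\<close>.
\<close>

lemma edge_local_time_eq: "edge_local_time (position f) x n = ups f n (x - 1) + downs f n x"
proof (induction n)
  case (Suc n)
  have "crossed_edge (position f) (Suc n) = (if step_bit f n then position f n + 1 else position f n)"
    unfolding position_eq_path by (rule crossed_edge_path)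
  then show ?case
    using Suc by (auto simp: edge_local_time_Suc ups_Suc downs_Suc)
qed simp

text \<open>
Up and down crossings of an edge alternate, and they balance unless the edge separates the current
position from the origin.
\<close>

lemma ups_minus_downs:
  "int (ups f n x) - int (downs f n (x + 1)) = of_bool (x < position f n) - of_bool (x < 0)"
proof (induction n)
  case (Suc n)
  then show ?case by (auto simp: ups_Suc downs_Suc position_Suc)
qed simp

lemma downs_le_ups: "x \<ge> 0 \<Longrightarrow> downs f n (x + 1) \<le> ups f n x"
  using ups_minus_downs[of f n x] by (auto simp: of_bool_def split: if_splits)

lemma downs_eq_ups: "x \<ge> 0 \<Longrightarrow> position f n \<le> x \<Longrightarrow> downs f n (x + 1) = ups f n x"
  using ups_minus_downs[of f n x] by auto

text \<open>
The walk is now on the side of \<open>x\<close> towards which it last left \<open>x\<close>.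
\<close>

lemma last_departure:
  "visits f n x > 0 \<Longrightarrow> position f n \<noteq> x \<Longrightarrow> f (x, visits f n x - 1) \<longleftrightarrow> x < position f n"
proof (induction n)
  case (Suc n)
  show ?case
  proof (cases "position f n = x")
    case True
    then show ?thesis by (auto simp: visits_Suc position_Suc step_bit_def)
  next
    case False
    then show ?thesis using Suc by (auto simp: visits_Suc position_Suc split: if_splits)
  qed
qed simp

lemma downs_pos_if_left: "visits f n x > 0 \<Longrightarrow> position f n < x \<Longrightarrow>
    downs f n x = Suc (up_count (\<lambda>i. \<not> f (x, i)) (visits f n x - 1))"
  using last_departure[of f n x] up_count_Suc[of "\<lambda>i. \<not> f (x, i)" "visits f n x - 1"]
  by (simp add: downs_def)

text \<open>
At an arbitrary time the crossing numbers are dominated by the branching process, because the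
current excursion can only be incomplete.
\<close>

lemma ups_le_if_ups_before:
  assumes x: "x \<ge> 0" and z: "ups f n x \<le> z" and z': "ups_before (\<lambda>i. f (x + 1, i)) z z'"
  shows "ups f n (x + 1) \<le> z'"
proof (rule ccontr)
  assume not: "\<not> ups f n (x + 1) \<le> z'"
  let ?c = "visits f n (x + 1)"
  let ?down = "up_count (\<lambda>i. \<not> f (x + 1, i))"
  have up: "up_count (\<lambda>i. f (x + 1, i)) (z + z') = z'"
    using z' by (auto simp: ups_before_def split: if_splits)
  then have down: "?down (z + z') = z"
    using up_count_add_down_count[of "\<lambda>i. f (x + 1, i)" "z + z'"] by simp
  \<comment> \<open>Too many up steps mean that the walk has gone past the \<open>z\<close>-th down bit of this stack.  Then all
    \<open>z\<close> excursions above \<open>x\<close> are closed, so the last bit used there is a further down bit.\<close>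
  have c: "?c > z + z'"
  proof (rule ccontr)
    assume "\<not> z + z' < ?c"
    then have "ups f n (x + 1) \<le> z'"
      using up_count_mono[of ?c "z + z'" "\<lambda>i. f (x + 1, i)"] up by (simp add: ups_def)
    with not show False by simp
  qed
  have "z \<le> downs f n (x + 1)"
    using up_count_mono[of "z + z'" ?c "\<lambda>i. \<not> f (x + 1, i)"] c down by (simp add: downs_def)
  then have d: "downs f n (x + 1) = z" "ups f n x = z"
    using downs_le_ups[OF x, of f n] z by auto
  then have "position f n \<le> x"
    using ups_minus_downs[of f n x] x by (auto simp: of_bool_def split: if_splits)
  then have "downs f n (x + 1) = Suc (?down (?c - 1))"
    using c by (intro downs_pos_if_left) auto
  moreover have "?down (?c - 1) \<ge> z"
    using up_count_mono[of "z + z'" "?c - 1" "\<lambda>i. \<not> f (x + 1, i)"] c down by simp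
  ultimately show False using d by simp
qed

text \<open>
Once the walk is back at \<open>x\<close> or to the left of it, the excursions above \<open>x\<close> are complete: there are as
many down steps from \<open>x + 1\<close> as up steps from \<open>x\<close>, and the last bit used at \<open>x + 1\<close> is down.  So
the crossing numbers follow the branching process exactly.
\<close>

lemma ups_before_ups:
  assumes x: "x \<ge> 0" and pos: "position f n \<le> x"
  shows "ups_before (\<lambda>i. f (x + 1, i)) (ups f n x) (ups f n (x + 1))"
proof (cases "visits f n (x + 1) > 0")
  case True
  have d: "downs f n (x + 1) = ups f n x" by (rule downs_eq_ups[OF x pos])
  have dp: "downs f n (x + 1) > 0" using downs_pos_if_left[OF True] pos by simp
  have v: "visits f n (x + 1) = ups f n x + ups f n (x + 1)"
    using ups_add_downs[of f n "x + 1"] d by simp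
  have "\<not> f (x + 1, visits f n (x + 1) - 1)"
    using last_departure[OF True] pos by auto
  moreover have "up_count (\<lambda>i. f (x + 1, i)) (visits f n (x + 1)) = ups f n (x + 1)"
    by (simp add: ups_def)
  ultimately show ?thesis
    using dp d unfolding v by (simp add: ups_before_def)
next
  case False
  then have "downs f n (x + 1) = 0" "ups f n (x + 1) = 0" by (simp_all add: downs_def ups_def)
  then show ?thesis using downs_eq_ups[OF x pos] by (simp add: ups_before_def)
qed

lemma ups_le_if_stays_below:
  assumes "x \<ge> 0" "ups f n x \<le> z" "stays_below m P N (\<lambda>(y, i). f (x + 1 + int y, i)) z" "k \<le> N"
  shows "ups f n (x + int k) \<le> m"
  using assms
proof (induction N arbitrary: x z k)
  case 0
  then show ?case by auto
next
  case (Suc N)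
  obtain z' where z': "z \<le> m" "ups_before (\<lambda>i. f (x + 1, i)) z z'"
    "stays_below m P N (\<lambda>(y, i). f (x + 1 + 1 + int y, i)) z'"
    using Suc.prems(3) by (auto simp: algebra_simps)
  show ?case
  proof (cases k)
    case 0
    then show ?thesis using Suc.prems(2) z'(1) by simp
  next
    case (Suc k')
    have "ups f n (x + 1) \<le> z'"
      by (rule ups_le_if_ups_before[OF Suc.prems(1,2) z'(2)])
    then have "ups f n (x + 1 + int k') \<le> m"
      using Suc.prems(1,4) z'(3) Suc by (intro Suc.IH) auto
    then show ?thesis using Suc by (simp add: algebra_simps)
  qed
qed

lemma stays_below_if_ups_le:
  assumes "x \<ge> 0" "position f n \<le> x" "\<And>k. k \<le> N \<Longrightarrow> ups f n (x + int k) \<le> m" "ups f n (x + int N) = 0"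
  shows "stays_below m (\<lambda>z. z = 0) N (\<lambda>(y, i). f (x + 1 + int y, i)) (ups f n x)"
  using assms
proof (induction N arbitrary: x)
  case 0
  then show ?case by simp
next
  case (Suc N)
  have "stays_below m (\<lambda>z. z = 0) N (\<lambda>(y, i). f ((x + 1) + 1 + int y, i)) (ups f n (x + 1))"
  proof (rule Suc.IH)
    show "ups f n (x + 1 + int k) \<le> m" if "k \<le> N" for k
      using Suc.prems(3)[of "Suc k"] that by (simp add: algebra_simps)
    show "ups f n (x + 1 + int N) = 0" using Suc.prems(4) by (simp add: algebra_simps)
  qed (use Suc.prems in auto)
  moreover have "ups f n x \<le> m" using Suc.prems(3)[of 0] by simp
  ultimately show ?case
    using ups_before_ups[OF Suc.prems(1,2)] by (auto simp: algebra_simps)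
qed

lemma abs_position_le: "\<bar>position f n\<bar> \<le> int n"
  by (induction n) (auto simp: position_Suc)

lemma visits_eq_0: "int n \<le> \<bar>x\<bar> \<Longrightarrow> visits f n x = 0"
proof (induction n)
  case (Suc n)
  then show ?case using abs_position_le[of f n] by (auto simp: visits_Suc)
qed simp

lemma mirror_walk: "position (mirror_stacks f) n = - position f n \<and> visits (mirror_stacks f) n x = visits f n (- x)"
proof (induction n arbitrary: x)
  case (Suc n)
  have "step_bit (mirror_stacks f) n \<longleftrightarrow> \<not> step_bit f n"
    using Suc by (simp add: step_bit_def mirror_stacks_def)
  then show ?case using Suc by (auto simp: position_Suc visits_Suc)
qed simp

lemmas position_mirror = mirror_walk[THEN conjunct1]

lemmas visits_mirror = mirror_walk[THEN conjunct2]

lemma ups_mirror: "ups (mirror_stacks f) n x = downs f n (- x)"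
  and downs_mirror: "downs (mirror_stacks f) n x = ups f n (- x)"
  unfolding ups_def downs_def visits_mirror by (simp_all add: mirror_stacks_def)

lemma edge_local_time_mirror:
  "edge_local_time (position (mirror_stacks f)) x n = edge_local_time (position f) (1 - x) n"
  by (simp add: edge_local_time_eq ups_mirror downs_mirror)

text \<open>
On the right half-line an edge is crossed downwards at most as often as upwards.
\<close>

lemma local_time_right_le:
  assumes "visits f n 0 \<le> r" "\<not> right_overshoot r m h f" "1 \<le> x" "x \<le> int h + 1"
  shows "edge_local_time (position f) x n \<le> 2 * m"
proof -
  have "ups f n 0 \<le> right_start f r"
    unfolding ups_def right_start_def by (rule up_count_mono) fact
  then have "ups f n (0 + int (nat (x - 1))) \<le> m"
    using assms by (intro ups_le_if_stays_below[where N = h and P = "\<lambda>_. True" and z = "right_start f r"])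
      (auto simp: right_overshoot_def right_stacks_def)
  moreover have "downs f n (x - 1 + 1) \<le> ups f n (x - 1)"
    using assms by (intro downs_le_ups) auto
  ultimately show ?thesis using assms by (simp add: edge_local_time_eq)
qed

text \<open>
Since the walk has never left the vertex \<open>N\<close>, the branching process is extinct there; it can leave
the event only by exceeding \<open>m\<close> at some edge, whose local time is twice its up crossings.
\<close>

lemma local_time_right_gt:
  assumes "position f n = 0" "visits f n 0 = r" "n \<le> N"
    and "\<not> stays_below m (\<lambda>z. z = 0) N (right_stacks f) (right_start f r)"
  shows "\<exists>y. 2 * m < edge_local_time (position f) y n"
proof -
  have "ups f n (0 + int N) = 0"
    using assms(3) by (simp add: ups_def visits_eq_0)
  moreover have "ups f n 0 = right_start f r" using assms(2) by (simp add: ups_def right_start_def)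
  ultimately have "\<exists>k\<le>N. m < ups f n (0 + int k)"
    using assms(1,4) stays_below_if_ups_le[of 0 f n N m] by (force simp: right_stacks_def)
  then obtain k where k: "m < ups f n (int k)" by auto
  moreover have "downs f n (int k + 1) = ups f n (int k)"
    using assms(1) by (intro downs_eq_ups) auto
  ultimately have "2 * m < edge_local_time (position f) (int k + 1) n"
    by (simp add: edge_local_time_eq)
  then show ?thesis ..
qed

lemma visit_time_exists: "r < visits f n 0 \<Longrightarrow> \<exists>T\<le>n. position f T = 0 \<and> visits f T 0 = r"
proof (induction n)
  case (Suc n)
  show ?case
  proof (cases "r < visits f n 0")
    case True
    then show ?thesis using Suc.IH le_SucI by blast
  next
    case False
    then have "position f n = 0 \<and> visits f n 0 = r"
      using Suc.prems by (auto simp: visits_Suc of_bool_def split: if_splits)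
    then show ?thesis using le_SucI[OF order_refl] by blast
  qed
qed simp

text \<open>
Local times grow with time.  The far edge has local time above \<open>2 * m\<close> already at the visit number
\<open>r\<close> to the origin, whereas the near edges would stay at or below \<open>2 * m\<close> even after \<open>r'\<close>
departures from it.
\<close>

lemma favorite_far_from_origin:
  assumes r: "r < visits f n 0" "visits f n 0 \<le> r'" and N: "n \<le> N"
    and small: "\<not> both_sides_small r m N f"
    and over: "\<not> right_overshoot r' m h f" "\<not> right_overshoot r' m h (mirror_stacks f)"
  obtains y where "\<And>x. \<bar>x\<bar> \<le> int h \<Longrightarrow> edge_local_time (position f) x n < edge_local_time (position f) y n"
proof -
  \<comment> \<open>At time \<open>T\<close> the walk is at the origin with exactly \<open>r\<close> departures behind it.\<close>
  obtain T where T: "T \<le> n" "position f T = 0" "visits f T 0 = r"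
    using visit_time_exists[OF r(1)] by blast
  have "\<exists>y. 2 * m < edge_local_time (position f) y T"
  proof (cases "stays_below m (\<lambda>z. z = 0) N (right_stacks f) (right_start f r)")
    case True
    with small have "\<not> stays_below m (\<lambda>z. z = 0) N (right_stacks (mirror_stacks f)) (right_start (mirror_stacks f) r)"
      by (simp add: both_sides_small_def)
    then have "\<exists>y. 2 * m < edge_local_time (position (mirror_stacks f)) y T"
      using T N by (intro local_time_right_gt[where N = N]) (auto simp: position_mirror visits_mirror)
    then show ?thesis by (auto simp: edge_local_time_mirror)
  next
    case False
    then show ?thesis using T N by (intro local_time_right_gt[where N = N]) auto
  qed
  then obtain y where "2 * m < edge_local_time (position f) y T" ..
  then have y: "2 * m < edge_local_time (position f) y n"
    using edge_local_time_mono[OF T(1)] by (rule less_le_trans)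
  have "edge_local_time (position f) x n \<le> 2 * m" if "\<bar>x\<bar> \<le> int h" for x
  proof (cases "x \<ge> 1")
    case True
    then show ?thesis using that local_time_right_le[OF r(2) over(1)] by auto
  next
    case False
    have "edge_local_time (position (mirror_stacks f)) (1 - x) n \<le> 2 * m"
      using that False r(2) by (intro local_time_right_le[OF _ over(2)]) (auto simp: position_mirror visits_mirror)
    then show ?thesis by (simp add: edge_local_time_mirror)
  qed
  with y that[of y] show ?thesis by fastforce
qed

lemma local_time_edge_1_le: "edge_local_time (position f) 1 n \<le> 2 * visits f n 0"
  using downs_le_ups[of 0 f n] ups_add_downs[of f n 0] by (simp add: edge_local_time_eq)

section \<open>Law of the stack-driven walk\<close>

definition path_visits :: "(nat \<Rightarrow> bool) \<Rightarrow> nat \<Rightarrow> int \<Rightarrow> nat" where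
  "path_visits b n x = card {k. k < n \<and> walk_path b k = x}"

lemma path_visits_Suc: "path_visits b (Suc n) x = path_visits b n x + of_bool (walk_path b n = x)"
proof -
  have "{k. k < Suc n \<and> walk_path b k = x} =
     (if walk_path b n = x then insert n {k. k < n \<and> walk_path b k = x} else {k. k < n \<and> walk_path b k = x})"
    by (auto simp: less_Suc_eq)
  then show ?thesis by (simp add: path_visits_def)
qed

lemma path_visits_mono: "m \<le> n \<Longrightarrow> path_visits b m x \<le> path_visits b n x"
  by (rule lift_Suc_mono_le) (auto simp: path_visits_Suc)

text \<open>
The stack entry read in step \<open>n\<close> by a walk that follows the steps \<open>b\<close>.
\<close>

definition used_bit :: "(nat \<Rightarrow> bool) \<Rightarrow> nat \<Rightarrow> int \<times> nat" where
  "used_bit b n = (walk_path b n, path_visits b n (walk_path b n))"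

lemma used_bit_new: "used_bit b n \<notin> used_bit b ` {..<n}"
proof
  assume "used_bit b n \<in> used_bit b ` {..<n}"
  then obtain k where k: "k < n" "walk_path b n = walk_path b k" "path_visits b n (walk_path b k) = path_visits b k (walk_path b k)"
    by (auto simp: used_bit_def)
  then show False
    using path_visits_mono[of "Suc k" n b "walk_path b k"] by (simp add: path_visits_Suc)
qed

lemma follows_path:
  "(\<And>k. k < n \<Longrightarrow> step_bit f k = b k) \<Longrightarrow> position f n = walk_path b n \<and> visits f n = path_visits b n"
proof (induction n)
  case 0
  then show ?case by (simp add: path_visits_def fun_eq_iff)
next
  case (Suc n)
  then have "position f n = walk_path b n" "visits f n = path_visits b n" by auto
  then show ?case
    using Suc.prems[of n] by (simp add: position_Suc walk_path_Suc fun_eq_iff visits_Suc path_visits_Suc)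
qed

lemma follows_Suc:
  "(\<forall>k<Suc n. step_bit f k = b k) \<longleftrightarrow> (\<forall>k<n. step_bit f k = b k) \<and> f (used_bit b n) = b n"
  using follows_path[of n f b] by (auto simp: less_Suc_eq step_bit_def used_bit_def)

lemma depends_on_follows: "depends_on (\<lambda>f. \<forall>k<n. step_bit f k = b k) (used_bit b ` {..<n})"
proof (induction n)
  case 0
  then show ?case by (intro depends_onI) auto
next
  case (Suc n)
  have "depends_on (\<lambda>f. f (used_bit b n) = b n) {used_bit b n}" by (intro depends_onI) auto
  from depends_on_conj[OF Suc.IH this] show ?case
    by (simp add: follows_Suc lessThan_Suc)
qed

text \<open>
Following prescribed steps amounts to prescribing \<open>n\<close> pairwise different stack entries.
\<close>

lemma prob_follows:
  assumes f: "fair_bits M \<eta>"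
  shows "bit_prob M \<eta> (\<lambda>f. \<forall>k<n. step_bit f k = b k) = 1 / 2 ^ n"
proof (induction n)
  case 0
  then show ?case using bit_prob_const[OF f, of True] by simp
next
  case (Suc n)
  have single: "bit_prob M \<eta> (\<lambda>f. f (used_bit b n) = b n) = 1 / 2"
  proof -
    have "bit_prob M \<eta> (\<lambda>f. \<forall>i\<in>{used_bit b n}. f i \<longleftrightarrow> i \<in> {p. p = used_bit b n \<and> b n}) = 1 / 2 ^ card {used_bit b n}"
      by (rule fair_on_pattern[OF fair_bits_fair_on[OF f]]) auto
    then show ?thesis by simp
  qed
  have "bit_prob M \<eta> (\<lambda>f. (\<forall>k<n. step_bit f k = b k) \<and> f (used_bit b n) = b n)
      = bit_prob M \<eta> (\<lambda>f. \<forall>k<n. step_bit f k = b k) * bit_prob M \<eta> (\<lambda>f. f (used_bit b n) = b n)"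
  proof (rule bit_prob_indep[OF f _ _ _ depends_on_follows])
    show "depends_on (\<lambda>f. f (used_bit b n) = b n) {used_bit b n}" by (intro depends_onI) auto
    show "used_bit b ` {..<n} \<inter> {used_bit b n} = {}" using used_bit_new[of b n] by auto
  qed auto
  then show ?case by (simp add: follows_Suc Suc.IH single)
qed

text \<open>
Decomposing over the first steps of the walk bounds the set of stack entries that can matter.
\<close>

lemma depends_on_step_bit: "\<exists>K. finite K \<and> depends_on (\<lambda>f. step_bit f n) K"
proof -
  let ?I = "{A. A \<subseteq> {..<Suc n} \<and> n \<in> A}"
  have "depends_on (\<lambda>f. \<exists>A\<in>?I. \<forall>k<Suc n. step_bit f k = (k \<in> A)) (\<Union>A\<in>?I. used_bit (\<lambda>k. k \<in> A) ` {..<Suc n})"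
    by (rule depends_on_Bex) (rule depends_on_follows)
  moreover have "(\<exists>A\<in>?I. \<forall>k<Suc n. step_bit f k = (k \<in> A)) \<longleftrightarrow> step_bit f n" for f
  proof
    assume "step_bit f n"
    then show "\<exists>A\<in>?I. \<forall>k<Suc n. step_bit f k = (k \<in> A)"
      by (intro bexI[of _ "{k. k < Suc n \<and> step_bit f k}"]) auto
  qed auto
  ultimately have "depends_on (\<lambda>f. step_bit f n) (\<Union>A\<in>?I. used_bit (\<lambda>k. k \<in> A) ` {..<Suc n})"
    by simp
  moreover have "finite (\<Union>A\<in>?I. used_bit (\<lambda>k. k \<in> A) ` {..<Suc n})" by simp
  ultimately show ?thesis by blast
qed

lemma fair_on_step_bits:
  assumes f: "fair_bits M \<eta>"
  shows "fair_on M (\<lambda>k \<omega>. step_bit (\<lambda>i. \<eta> i \<omega>) k) {..<n}"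
proof (rule fair_onI)
  show "prob_space M" by (rule fair_bits_prob_space[OF f])
  show "{\<omega> \<in> space M. step_bit (\<lambda>i. \<eta> i \<omega>) k} \<in> sets M" for k
    using depends_on_step_bit[of k] fair_bits_event[OF f, of _ "\<lambda>f. step_bit f k"] by blast
  show "bit_prob M (\<lambda>k \<omega>. step_bit (\<lambda>i. \<eta> i \<omega>) k) (\<lambda>f. \<forall>i\<in>{..<n}. f i \<longleftrightarrow> i \<in> A) = 1 / 2 ^ card {..<n}" for A
    using prob_follows[OF f, of n "\<lambda>k. k \<in> A"] by (simp add: bit_prob_def Ball_def)
qed simp

section \<open>A lower bound for the local time next to the origin\<close>

text \<open>
Crossings of edge \<open>1\<close>, between \<open>0\<close> and \<open>1\<close>, by the walk started from \<open>s\<close>.  The starting point is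
general to allow a recursion on the first step.
\<close>

primrec crossings :: "int \<Rightarrow> (nat \<Rightarrow> bool) \<Rightarrow> nat \<Rightarrow> nat" where
  "crossings s b 0 = 0"
| "crossings s b (Suc n) = of_bool (s = 0 \<and> b 0 \<or> s = 1 \<and> \<not> b 0) +
     crossings (if b 0 then s + 1 else s - 1) (\<lambda>i. b (Suc i)) n"

lemma walk_path_shift: "walk_path b (Suc n) = (if b 0 then 1 else - 1) + walk_path (\<lambda>i. b (Suc i)) n"
  by (induction n) (simp_all add: walk_path_Suc)

lemma crossed_edge_translate: "crossed_edge (\<lambda>k. s + p k) i = s + crossed_edge p i"
proof -
  have "(s + p i + (s + p (i - 1)) + 1) div 2 = (2 * s + (p i + p (i - 1) + 1)) div 2"
    by (simp add: algebra_simps)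
  then show ?thesis by (simp add: crossed_edge_def)
qed

lemma crossings_eq: "edge_local_time (\<lambda>k. s + walk_path b k) 1 n = crossings s b n"
proof (induction n arbitrary: s b)
  case (Suc n)
  let ?s = "if b 0 then s + 1 else s - 1"
  let ?p = "\<lambda>k. s + walk_path b k"
  let ?q = "\<lambda>k. ?s + walk_path (\<lambda>i. b (Suc i)) k"
  have pq: "?p (Suc k) = ?q k" for k by (simp add: walk_path_shift)
  have cross: "crossed_edge ?p (Suc (Suc k)) = crossed_edge ?q (Suc k)" for k
    unfolding crossed_edge_def diff_Suc_1 pq ..
  have "{j. 1 \<le> j \<and> j \<le> Suc n \<and> crossed_edge ?p j = 1} =
      {j. j = 1 \<and> crossed_edge ?p 1 = 1} \<union> Suc ` {j. 1 \<le> j \<and> j \<le> n \<and> crossed_edge ?q j = 1}"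
    (is "?A = ?B \<union> Suc ` ?C")
  proof (intro set_eqI iffI)
    fix j assume j: "j \<in> ?A"
    show "j \<in> ?B \<union> Suc ` ?C"
    proof (cases "j = 1")
      case True
      then show ?thesis using j by auto
    next
      case False
      then obtain k where k: "j = Suc (Suc k)" using j by (cases j; cases "j - 1") auto
      then have "Suc k \<in> ?C" using j cross[of k] by auto
      then show ?thesis unfolding k by blast
    qed
  next
    fix j assume "j \<in> ?B \<union> Suc ` ?C"
    then show "j \<in> ?A"
    proof
      assume "j \<in> Suc ` ?C"
      then obtain i where i: "j = Suc i" "i \<in> ?C" by blast
      then obtain k where "i = Suc k" by (cases i) auto
      then show ?thesis using i cross[of k] by auto
    qed auto
  qed
  moreover have "?B \<inter> Suc ` ?C = {}" by auto
  moreover have "card ?B = of_bool (s = 0 \<and> b 0 \<or> s = 1 \<and> \<not> b 0)"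
  proof -
    have "crossed_edge ?p 1 = (if b 0 then s + 1 else s)"
      using crossed_edge_path[of b 0] by (simp add: crossed_edge_translate)
    then have "?B = (if s = 0 \<and> b 0 \<or> s = 1 \<and> \<not> b 0 then {1} else {})" by auto
    then show ?thesis by simp
  qed
  moreover have "card (Suc ` ?C) = crossings ?s (\<lambda>i. b (Suc i)) n"
    using Suc.IH[of ?s "\<lambda>i. b (Suc i)"] by (simp add: card_image edge_local_time_def)
  ultimately show ?case
    by (simp add: edge_local_time_def card_Un_disjoint)
qed simp

lemma depends_on_crossings: "depends_on (\<lambda>b. crossings s b n < \<rho>) {..<n}"
proof -
  have *: "crossings s f n = crossings s g n" if "\<And>i. i < n \<Longrightarrow> f i = g i" for s n and f g :: "nat \<Rightarrow> bool"
    using that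
  proof (induction n arbitrary: s f g)
    case (Suc n)
    have "crossings t (\<lambda>i. f (Suc i)) n = crossings t (\<lambda>i. g (Suc i)) n" for t
      using Suc.prems by (intro Suc.IH) auto
    then show ?case using Suc.prems[of 0] by simp
  qed simp
  show ?thesis
  proof (rule depends_onI)
    fix f g :: "nat \<Rightarrow> bool" assume "\<And>i. i \<in> {..<n} \<Longrightarrow> f i = g i" and "crossings s f n < \<rho>"
    then show "crossings s g n < \<rho>" using *[of n f g s] by simp
  qed
qed

text \<open>
Conditioning on the first step of a random walk.
\<close>

lemma prob_first_bit:
  assumes f: "fair_bits M X" and K: "finite K"
    and Q: "\<And>v. depends_on (Q v) K"
  shows "bit_prob M X (\<lambda>b. Q (b 0) (\<lambda>i. b (Suc i)))
    = (bit_prob M (\<lambda>i. X (Suc i)) (Q True) + bit_prob M (\<lambda>i. X (Suc i)) (Q False)) / 2"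
proof -
  let ?R = "\<lambda>v b. b 0 = v \<and> Q v (\<lambda>i. b (Suc i))"
  have d0: "depends_on (\<lambda>b. b 0 = v) {0::nat}" for v by (intro depends_onI) auto
  have dQ: "depends_on (\<lambda>b. Q v (\<lambda>i. b (Suc i))) (Suc ` K)" for v by (rule depends_on_reindex[OF Q])
  have half: "bit_prob M X (\<lambda>b. b 0 = v) = 1 / 2" for v
  proof -
    have "bit_prob M X (\<lambda>f. \<forall>i\<in>{0}. f i \<longleftrightarrow> i \<in> {p. p = 0 \<and> v}) = 1 / 2 ^ card {0::nat}"
      by (rule fair_on_pattern[OF fair_bits_fair_on[OF f]]) auto
    then show ?thesis by simp
  qed
  have "(\<lambda>b. Q (b 0) (\<lambda>i. b (Suc i))) = (\<lambda>b. \<exists>v\<in>UNIV. ?R v b)" by auto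
  then have "bit_prob M X (\<lambda>b. Q (b 0) (\<lambda>i. b (Suc i))) = bit_prob M X (\<lambda>b. \<exists>v\<in>UNIV. ?R v b)" by (rule arg_cong)
  also have "\<dots> = (\<Sum>v\<in>UNIV. bit_prob M X (?R v))"
  proof (rule bit_prob_disjoint_Ex[OF f])
    show "depends_on (?R v) ({0} \<union> Suc ` K)" for v by (rule depends_on_conj[OF d0 dQ])
  qed (use K in auto)
  also have "\<dots> = (\<Sum>v\<in>UNIV. 1 / 2 * bit_prob M (\<lambda>i. X (Suc i)) (Q v))"
  proof (intro sum.cong refl)
    fix v
    have "bit_prob M X (?R v) = bit_prob M X (\<lambda>b. b 0 = v) * bit_prob M X (\<lambda>b. Q v (\<lambda>i. b (Suc i)))"
      by (rule bit_prob_indep[OF f _ _ _ d0 dQ]) (use K in auto)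
    then show "bit_prob M X (?R v) = 1 / 2 * bit_prob M (\<lambda>i. X (Suc i)) (Q v)"
      by (simp add: half) (simp add: bit_prob_def)
  qed
  finally show ?thesis by (simp add: UNIV_bool)
qed

text \<open>
The probability that a simple random walk started from \<open>d \<ge> 0\<close> does not hit \<open>0\<close> within \<open>n\<close> steps.
\<close>

primrec avoid_zero :: "nat \<Rightarrow> nat \<Rightarrow> real" where
  "avoid_zero 0 d = of_bool (0 < d)"
| "avoid_zero (Suc n) d = (if d = 0 then 0 else (avoid_zero n (d - 1) + avoid_zero n (d + 1)) / 2)"

text \<open>
The probability that a simple random walk started from \<open>d\<close> stays strictly between \<open>0\<close> and \<open>R\<close>
for \<open>n\<close> steps.
\<close>

primrec stay_inside :: "nat \<Rightarrow> nat \<Rightarrow> nat \<Rightarrow> real" where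
  "stay_inside R 0 d = of_bool (0 < d \<and> d < R)"
| "stay_inside R (Suc n) d =
     (if 0 < d \<and> d < R then (stay_inside R n (d - 1) + stay_inside R n (d + 1)) / 2 else 0)"

lemma avoid_zero_bounds: "0 \<le> avoid_zero n d \<and> avoid_zero n d \<le> 1"
proof (induction n arbitrary: d)
  case (Suc n)
  show ?case using Suc[of "d - 1"] Suc[of "d + 1"] by (auto simp: field_simps)
qed auto

lemma stay_inside_nonneg: "0 \<le> stay_inside R n d"
  by (induction n arbitrary: d) auto

lemma stay_inside_Suc_le: "stay_inside R (Suc n) d \<le> stay_inside R n d"
proof (induction n arbitrary: d)
  case (Suc n)
  then show ?case
    using add_mono[OF Suc.IH[of "d - 1"] Suc.IH[of "d + 1"]] by (auto simp del: stay_inside.simps(2) simp: stay_inside.simps(2)[of R "Suc n"] stay_inside.simps(2)[of R n d])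
qed auto

text \<open>
The sum over all \<open>k\<close> is the expected exit time from the interval, which is \<open>d * (R - d)\<close>.
\<close>

lemma sum_stay_inside_le: "d \<le> R \<Longrightarrow> (\<Sum>k<n. stay_inside R k d) \<le> real d * (real R - real d)"
proof (induction n arbitrary: d)
  case (Suc n)
  show ?case
  proof (cases "0 < d \<and> d < R")
    case True
    have "(\<Sum>k<Suc n. stay_inside R k d) = 1 + ((\<Sum>k<n. stay_inside R k (d - 1)) + (\<Sum>k<n. stay_inside R k (d + 1))) / 2"
      using True by (simp only: sum.lessThan_Suc_shift) (simp add: sum.distrib sum_divide_distrib add_divide_distrib)
    also have "\<dots> \<le> 1 + (real (d - 1) * (real R - real (d - 1)) + real (d + 1) * (real R - real (d + 1))) / 2"
      using True by (intro add_left_mono divide_right_mono add_mono Suc.IH) auto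
    also have "\<dots> = real d * (real R - real d)"
      using True by (simp add: of_nat_diff field_simps)
    finally show ?thesis .
  next
    case False
    then have "stay_inside R k d = 0" for k by (cases k) auto
    then show ?thesis using Suc.prems by simp
  qed
qed simp

lemma stay_inside_le:
  assumes "d \<le> R"
  shows "real n * stay_inside R n d \<le> real d * (real R - real d)"
proof -
  have "stay_inside R n d \<le> stay_inside R k d" if "k \<le> n" for k
    by (rule lift_Suc_antimono_le[of "\<lambda>n. stay_inside R n d", OF stay_inside_Suc_le that])
  then have "(\<Sum>k<n. stay_inside R n d) \<le> (\<Sum>k<n. stay_inside R k d)"
    by (intro sum_mono) auto
  with sum_stay_inside_le[OF assms, of n] show ?thesis by simp
qed

text \<open>
Gambler's ruin: a walk that avoids \<open>0\<close> either stays inside the interval or reaches \<open>R\<close> first.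
\<close>

lemma avoid_zero_le: "R > 0 \<Longrightarrow> avoid_zero n d \<le> stay_inside R n d + real d / real R"
proof (induction n arbitrary: d)
  case 0
  then show ?case by (auto simp: field_simps)
next
  case (Suc n)
  consider "d = 0" | "0 < d \<and> d < R" | "d \<ge> R" by linarith
  then show ?case
  proof cases
    case 2
    have "(avoid_zero n (d - 1) + avoid_zero n (d + 1)) / 2
      \<le> ((stay_inside R n (d - 1) + real (d - 1) / real R) + (stay_inside R n (d + 1) + real (d + 1) / real R)) / 2"
      by (intro divide_right_mono add_mono Suc.IH Suc.prems) simp
    also have "\<dots> = (stay_inside R n (d - 1) + stay_inside R n (d + 1)) / 2 + real d / real R"
      using 2 by (simp add: of_nat_diff field_simps)
    finally show ?thesis using 2 by simp
  next
    case 3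
    then have "1 \<le> real d / real R" using Suc.prems by simp
    then show ?thesis using avoid_zero_bounds[of "Suc n" d] stay_inside_nonneg[of R "Suc n" d] by linarith
  qed simp
qed

text \<open>
A discrete Tanaka formula.  Let \<open>g s\<close> be the distance of \<open>s\<close> from the edge \<open>{0, 1}\<close>.  As long as
crossings are missing, their number plus \<open>g\<close> of the position is a simple random walk: a step across
the edge changes the first summand by \<open>- 1\<close>, any other step changes the second by \<open>1\<close> or \<open>- 1\<close>.
This walk is positive while crossings are missing.
\<close>

lemma prob_crossings_le:
  assumes "fair_bits M X"
  shows "bit_prob M X (\<lambda>b. crossings s b n < \<rho>) \<le>
    (if \<rho> = 0 then 0 else avoid_zero n (nat (if s \<ge> 1 then s - 1 else - s) + \<rho>))"
  using assms
proof (induction n arbitrary: X s \<rho>)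
  case 0
  show ?case
    using bit_prob_const[OF 0, of "0 < \<rho>"] by simp
next
  case (Suc n)
  let ?g = "\<lambda>s::int. nat (if s \<ge> 1 then s - 1 else - s)"
  have f': "fair_bits M (\<lambda>i. X (Suc i))" by (rule fair_bits_reindex[OF Suc.prems]) simp
  let ?P = "\<lambda>s \<rho>. bit_prob M (\<lambda>i. X (Suc i)) (\<lambda>b. crossings s b n < \<rho>)"
  show ?case
  proof (cases "\<rho> = 0")
    case True
    then show ?thesis using bit_prob_const[OF Suc.prems, of False] by simp
  next
    case False
    \<comment> \<open>A crossing of edge \<open>1\<close> lowers the number of missing crossings by one; the distance to the edge
      changes by one in every other case.\<close>
    let ?u = "\<rho> - of_bool (s = 0)" and ?d = "\<rho> - of_bool (s = 1)"
    have "bit_prob M X (\<lambda>b. crossings s b (Suc n) < \<rho>)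
       = bit_prob M X (\<lambda>b. (\<lambda>v b'. crossings (if v then s + 1 else s - 1) b' n < (if v then ?u else ?d)) (b 0) (\<lambda>i. b (Suc i)))"
      using False by (intro arg_cong[where f = "bit_prob M X"] ext) auto
    also have "\<dots> = (?P (s + 1) ?u + ?P (s - 1) ?d) / 2"
      by (subst prob_first_bit[OF Suc.prems, of "{..<n}"]) (auto intro: depends_on_crossings)
    finally have eq: "bit_prob M X (\<lambda>b. crossings s b (Suc n) < \<rho>) = (?P (s + 1) ?u + ?P (s - 1) ?d) / 2" .
    have le: "?P t \<rho>' \<le> avoid_zero n (?g t + \<rho>')" for t \<rho>'
      using Suc.IH[OF f', of t \<rho>'] avoid_zero_bounds[of n "?g t + \<rho>'"] by (auto split: if_splits)
    consider "s \<ge> 1" | "s \<le> 0" by linarith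
    then have "?P (s + 1) ?u + ?P (s - 1) ?d \<le> avoid_zero n (?g s + \<rho> - 1) + avoid_zero n (?g s + \<rho> + 1)"
    proof cases
      case 1
      have e1: "?g (s + 1) + ?u = ?g s + \<rho> + 1" using 1 by auto
      have e2: "?g (s - 1) + ?d = ?g s + \<rho> - 1" using 1 False by auto
      show ?thesis using le[of "s + 1" ?u, unfolded e1] le[of "s - 1" ?d, unfolded e2] by linarith
    next
      case 2
      have e1: "?g (s + 1) + ?u = ?g s + \<rho> - 1" using 2 False by auto
      have e2: "?g (s - 1) + ?d = ?g s + \<rho> + 1" using 2 by auto
      show ?thesis using le[of "s + 1" ?u, unfolded e1] le[of "s - 1" ?d, unfolded e2] by linarith
    qed
    then show ?thesis using False unfolding eq by simp
  qed
qed

lemma prob_local_time_less: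
  assumes f: "fair_bits M X" and R: "0 < R" and n: "0 < n"
  shows "bit_prob M X (\<lambda>b. edge_local_time (walk_path b) 1 n < \<rho>)
    \<le> real \<rho> / real R + real \<rho> * real R / real n"
proof (cases "\<rho> \<le> R")
  case True
  have "bit_prob M X (\<lambda>b. edge_local_time (walk_path b) 1 n < \<rho>) = bit_prob M X (\<lambda>b. crossings 0 b n < \<rho>)"
    using crossings_eq[of 0] by simp
  also have "\<dots> \<le> avoid_zero n \<rho>"
    using prob_crossings_le[OF f, of 0 n \<rho>] avoid_zero_bounds[of n \<rho>] by (auto split: if_splits)
  also have "\<dots> \<le> stay_inside R n \<rho> + real \<rho> / real R" by (rule avoid_zero_le[OF R])
  also have "stay_inside R n \<rho> \<le> real \<rho> * real R / real n"
  proof -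
    have "real n * stay_inside R n \<rho> \<le> real \<rho> * (real R - real \<rho>)" by (rule stay_inside_le[OF True])
    also have "\<dots> \<le> real \<rho> * real R" by (intro mult_left_mono) auto
    finally show ?thesis using n by (simp add: field_simps)
  qed
  finally show ?thesis by simp
next
  case False
  then have "1 \<le> real \<rho> / real R" using R by simp
  moreover have "0 \<le> real \<rho> * real R / real n" by simp
  ultimately show ?thesis using bit_prob_le_1[OF f, of "\<lambda>b. edge_local_time (walk_path b) 1 n < \<rho>"] by linarith
qed

section \<open>Favorite edges near the origin during one dyadic time block\<close>

definition favorite_near :: "nat \<Rightarrow> nat \<Rightarrow> nat \<Rightarrow> (nat \<Rightarrow> bool) \<Rightarrow> bool" where
  "favorite_near h n n' b \<longleftrightarrow>
     (\<exists>k x. n \<le> k \<and> k < n' \<and> \<bar>x\<bar> \<le> int h \<and> x \<in> favorite_edges (walk_path b) k)"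

lemma depends_on_favorite_near: "depends_on (favorite_near h n n') {..<n'}"
proof (rule depends_onI)
  fix f g :: "nat \<Rightarrow> bool" assume fg: "\<And>i. i \<in> {..<n'} \<Longrightarrow> f i = g i" and near: "favorite_near h n n' f"
  have eq: "favorite_edges (walk_path f) k = favorite_edges (walk_path g) k" if "k < n'" for k
  proof -
    have "edge_local_time (walk_path f) x k = edge_local_time (walk_path g) x k" for x
      by (rule edge_local_time_cong, rule walk_path_cong) (use fg that in auto)
    then show ?thesis by (simp add: favorite_edges_def)
  qed
  from near obtain k x where kx: "n \<le> k" "k < n'" "\<bar>x\<bar> \<le> int h" "x \<in> favorite_edges (walk_path f) k"
    unfolding favorite_near_def by blast
  from kx(4) have "x \<in> favorite_edges (walk_path g) k" unfolding eq[OF kx(2)] .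
  with kx(1-3) show "favorite_near h n n' g" unfolding favorite_near_def by blast
qed

text \<open>
The number of departures from the origin lies between two consecutive grid values \<open>r k\<close> and
\<open>r (Suc k)\<close>, and a favorite edge within distance \<open>h\<close> forces one of the exceptional events for
this \<open>k\<close>.
\<close>

lemma favorite_nearE:
  assumes near: "favorite_near h n n' (step_bit f)"
    and r: "r (0::nat) < visits f n 0" "n' \<le> r K" and N: "n' \<le> N"
  obtains k where "k < K" "both_sides_small (r k) (m k) N f \<or>
     right_overshoot (r (Suc k)) (m k) h f \<or> right_overshoot (r (Suc k)) (m k) h (mirror_stacks f)"
proof -
  obtain l x where lx: "n \<le> l" "l < n'" "\<bar>x\<bar> \<le> int h" "x \<in> favorite_edges (position f) l"
    using near unfolding favorite_near_def position_eq_path by blast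
  let ?c = "visits f l 0"
  have mono: "visits f i 0 \<le> visits f j 0" if "i \<le> j" for i j
    by (rule lift_Suc_mono_le[OF _ that]) (simp add: visits_Suc)
  have "visits f i 0 \<le> i" for i by (induction i) (auto simp: visits_Suc)
  from this[of l] have c: "r 0 < ?c" "?c \<le> r K" using mono[OF lx(1)] r lx(2) by linarith+
  \<comment> \<open>The first grid value that is not below the number of departures.\<close>
  define i where "i = (LEAST i. ?c \<le> r i)"
  have i: "?c \<le> r i" "i \<le> K" unfolding i_def by (rule LeastI[of _ K], rule c(2)) (rule Least_le, rule c(2))
  have "i \<noteq> 0" using i(1) c(1) by (metis leD)
  then obtain k where k: "i = Suc k" by (cases i) auto
  have "\<not> ?c \<le> r k" using not_less_Least[of k "\<lambda>i. ?c \<le> r i"] k unfolding i_def[symmetric] by simp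
  then have rk: "r k < ?c" "?c \<le> r (Suc k)" using i(1) unfolding k by linarith+
  have "both_sides_small (r k) (m k) N f \<or>
     right_overshoot (r (Suc k)) (m k) h f \<or> right_overshoot (r (Suc k)) (m k) h (mirror_stacks f)"
  proof (rule ccontr)
    assume not: "\<not> ?thesis"
    obtain y where y: "edge_local_time (position f) x l < edge_local_time (position f) y l"
      by (rule favorite_far_from_origin[OF rk, of N "m k" h]) (use not lx N in auto)
    have "edge_local_time (position f) y l \<le> (SUP y. edge_local_time (position f) y l)"
      by (rule cSUP_upper[OF _ bdd_above_local_times]) simp
    with y lx(4) show False by (simp add: favorite_edges_def)
  qed
  then show thesis using that[of k] i k by simp
qed

lemma finitary_both_sides_small: "finitary (both_sides_small r m N)"
  unfolding finitary_def by (rule depends_on_both_sides_small)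

lemma finitary_right_overshoot: "finitary (right_overshoot r m N)"
  unfolding finitary_def by (rule depends_on_right_overshoot)

lemma finitary_left_overshoot: "finitary (\<lambda>f. right_overshoot r m N (mirror_stacks f))"
proof -
  obtain K where K: "finite K" "depends_on (right_overshoot r m N) K"
    using depends_on_right_overshoot by blast
  have "depends_on (\<lambda>f. right_overshoot r m N (mirror_stacks f)) ((\<lambda>(x, i). (- x, i)) ` K)"
  proof (rule depends_onI)
    fix f g :: "int \<times> nat \<Rightarrow> bool"
    assume "\<And>p. p \<in> (\<lambda>(x, i). (- x, i)) ` K \<Longrightarrow> f p = g p" "right_overshoot r m N (mirror_stacks f)"
    moreover from this have "mirror_stacks f p = mirror_stacks g p" if "p \<in> K" for p
      using that by (force simp: mirror_stacks_def case_prod_unfold)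
    ultimately show "right_overshoot r m N (mirror_stacks g)"
      using depends_onD[OF K(2), of "mirror_stacks f" "mirror_stacks g"] by simp
  qed
  with K(1) show ?thesis unfolding finitary_def by blast
qed

lemma prob_left_overshoot:
  assumes f: "fair_bits M \<eta>" and m: "real r / 2 < real m"
  shows "bit_prob M \<eta> (\<lambda>f. right_overshoot r m N (mirror_stacks f)) \<le> (1/4 + real N) * real r / (real m - real r / 2)\<^sup>2"
  using prob_right_overshoot[OF fair_bits_mirror[OF f] m, of N] by (simp add: bit_prob_def)

lemma real_divide_le_Suc_div:
  assumes "0 < q"
  shows "real n / real q \<le> real (n div q) + 1"
proof -
  have "n \<le> (n div q + 1) * q"
    using assms dividend_less_div_times[of q n] by simp
  then have "real n \<le> (real (n div q) + 1) * real q"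
    by (metis of_nat_1 of_nat_add of_nat_le_iff of_nat_mult)
  then show ?thesis using assms by (simp add: divide_le_eq)
qed

text \<open>
Here \<open>1 / q\<close> is the relative grid spacing.  The threshold \<open>m\<close> exceeds \<open>r / 2\<close> by about \<open>2 * r / q\<close>, enough
to remain above \<open>r' / 2\<close> by \<open>r / q\<close>, and little enough for the two sides to stay below it jointly
only with probability of order \<open>1 / q\<^sup>2\<close>.
\<close>

lemma level_error_bound:
  fixes r q :: nat and m r' :: nat
  assumes f: "fair_bits M \<eta>" and q: "1 \<le> q" and r: "81 * q\<^sup>2 \<le> r"
    and r': "r' = r + r div q + 1" and m: "m = (r + 4 * (r div q)) div 2"
  shows "bit_prob M \<eta> (\<lambda>f. both_sides_small r m N f \<or> right_overshoot r' m h f \<or> right_overshoot r' m h (mirror_stacks f))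
    \<le> 25 / (real q)\<^sup>2 + 6 * (real h + 1) * (real q)\<^sup>2 / real r"
proof -
  define d where "d = real r / real q"
  have q0: "real q \<ge> 1" using q by simp
  have rq: "real r \<ge> 81 * (real q)\<^sup>2"
    using r by (metis of_nat_le_iff of_nat_mult of_nat_numeral of_nat_power)
  have r0: "real r \<ge> 81"
    using rq one_le_power[OF q0, of 2] by linarith
  have d: "d \<ge> 81"
  proof -
    have "81 * real q * real q \<le> real r" using rq by (simp add: power2_eq_square)
    moreover have "81 * real q * 1 \<le> 81 * real q * real q" using q0 by (intro mult_left_mono) auto
    ultimately have "81 * real q \<le> real r" by linarith
    then show ?thesis unfolding d_def using q0 by (simp add: le_divide_eq)
  qed
  have dr: "d \<le> real r" unfolding d_def using q0 r0 by (simp add: field_simps)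
  have div: "real (r div q) \<le> d" "d \<le> real (r div q) + 1"
    unfolding d_def using of_nat_div_le_of_nat[of r q] real_divide_le_Suc_div[of q r] q by auto
  have m2: "2 * real m \<le> real r + 4 * real (r div q)" "real r + 4 * real (r div q) \<le> 2 * real m + 1"
    unfolding m by linarith+
  have small: "bit_prob M \<eta> (both_sides_small r m N) \<le> 25 / (real q)\<^sup>2"
  proof -
    \<comment> \<open>The overshoot allowance \<open>\<kappa>\<close> is of order \<open>sqrt r\<close>; the hypothesis on \<open>r\<close> makes it smaller than
      the grid spacing \<open>d\<close>.\<close>
    define \<kappa> where "\<kappa> = sqrt (2 * real m) + 1"
    define \<mu> where "\<mu> = real m + 1 + \<kappa>"
    have \<kappa>: "\<kappa> \<ge> 1" "\<kappa>\<^sup>2 \<ge> 2 * real m" by (auto simp: \<kappa>_def power2_sum)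
    have s: "9 * sqrt (real r) \<le> d"
    proof -
      have "9 * real q \<le> sqrt (real r)"
        using rq by (intro real_le_rsqrt) (simp add: power2_eq_square)
      then have "9 * real q * sqrt (real r) \<le> sqrt (real r) * sqrt (real r)" by (intro mult_right_mono) auto
      then show ?thesis unfolding d_def using q0 by (simp add: field_simps)
    qed
    have "2 * \<kappa> + 2 \<le> d"
    proof -
      have "sqrt (2 * real m) \<le> sqrt (5 * real r)" using m2 div dr by simp
      also have "\<dots> \<le> sqrt (25/4 * real r)" by simp
      also have "\<dots> = 5/2 * sqrt (real r)" by (simp add: real_sqrt_mult real_sqrt_divide)
      finally have "sqrt (2 * real m) \<le> 5/2 * sqrt (real r)" .
      moreover have "4 \<le> 4 * sqrt (real r)" using r0 by simp
      moreover have "2 * (t + 1) + 2 \<le> 9 * u" if "t \<le> 5/2 * u" "4 \<le> 4 * u" for t u :: real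
        using that by argo
      ultimately have "2 * \<kappa> + 2 \<le> 9 * sqrt (real r)" unfolding \<kappa>_def by blast
      with s show ?thesis by simp
    qed
    then have mu_le: "2 * \<mu> \<le> real r + 5 * d" unfolding \<mu>_def using m2 div by argo
    have div0: "0 \<le> real (r div q)" by simp
    have mu_ge: "real r \<le> 2 * \<mu>" unfolding \<mu>_def using m2 \<kappa>(1) div0 by argo
    have mu0: "\<mu> > 0" using \<kappa> by (simp add: \<mu>_def)
    have "1 - real r / (2 * \<mu>) \<le> 1 - real r / (real r + 5 * d)"
      using mu_le mu0 d r0 by (intro diff_left_mono divide_left_mono) auto
    also have "\<dots> = 5 * d / (real r + 5 * d)" using d r0 by (simp add: field_simps)
    also have "\<dots> \<le> 5 * d / real r" using d r0 by (intro divide_left_mono) auto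
    also have "\<dots> = 5 / real q" unfolding d_def using r0 by simp
    finally have "1 - real r / (2 * \<mu>) \<le> 5 / real q" .
    moreover have "0 \<le> 1 - real r / (2 * \<mu>)" using mu_ge mu0 by simp
    ultimately have "(1 - real r / (2 * \<mu>))\<^sup>2 \<le> (5 / real q)\<^sup>2" by (rule power_mono)
    then show ?thesis
      using prob_both_sides_small[OF f \<kappa> \<mu>_def, of r N] by (simp add: power_divide)
  qed
  have gap: "real m - real r' / 2 \<ge> d"
  proof -
    have "real r' = real r + real (r div q) + 1" unfolding r' by simp
    then show ?thesis using m2 div d by argo
  qed
  have over: "(1/4 + real h) * real r' / (real m - real r' / 2)\<^sup>2 \<le> 3 * (real h + 1) * (real q)\<^sup>2 / real r"
  proof -
    have "(1/4 + real h) * real r' / (real m - real r' / 2)\<^sup>2 \<le> (real h + 1) * (3 * real r) / d\<^sup>2"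
    proof (intro frac_le mult_mono power_mono gap)
      show "real r' \<le> 3 * real r" using div dr r0 unfolding r' by simp
    qed (use d in auto)
    also have "\<dots> = 3 * (real h + 1) * (real q)\<^sup>2 / real r"
      unfolding d_def using r0 q0 by (simp add: power2_eq_square field_simps)
    finally show ?thesis .
  qed
  have rm: "real r' / 2 < real m" using gap d by linarith
  have "bit_prob M \<eta> (\<lambda>f. both_sides_small r m N f \<or> right_overshoot r' m h f \<or> right_overshoot r' m h (mirror_stacks f))
    \<le> bit_prob M \<eta> (both_sides_small r m N) + bit_prob M \<eta> (\<lambda>f. right_overshoot r' m h f \<or> right_overshoot r' m h (mirror_stacks f))"
    by (intro bit_prob_disj_le[OF f] finitary_both_sides_small finitary_disj finitary_right_overshoot finitary_left_overshoot)
  moreover have "bit_prob M \<eta> (\<lambda>f. right_overshoot r' m h f \<or> right_overshoot r' m h (mirror_stacks f))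
    \<le> bit_prob M \<eta> (right_overshoot r' m h) + bit_prob M \<eta> (\<lambda>f. right_overshoot r' m h (mirror_stacks f))"
    by (intro bit_prob_disj_le[OF f] finitary_right_overshoot finitary_left_overshoot)
  moreover have "3 * (real h + 1) * (real q)\<^sup>2 / real r + 3 * (real h + 1) * (real q)\<^sup>2 / real r
      = 6 * (real h + 1) * (real q)\<^sup>2 / real r" by (simp add: field_simps)
  ultimately show ?thesis
    using small over prob_right_overshoot[OF f rm, of h] prob_left_overshoot[OF f rm, of h] by linarith
qed

text \<open>
A geometric grid of ratio \<open>1 + 1 / q\<close> in natural numbers.  The final \<open>+ 1\<close> makes the growth at least
geometric in spite of the rounding.
\<close>

primrec level :: "nat \<Rightarrow> nat \<Rightarrow> nat \<Rightarrow> nat" where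
  "level q r0 0 = r0"
| "level q r0 (Suc k) = level q r0 k + level q r0 k div q + 1"

lemma level_ge: "r0 \<le> level q r0 k"
  by (induction k) auto

text \<open>
By Bernoulli's inequality \<open>q\<close> steps of the grid at least double its value.
\<close>

lemma level_growth:
  assumes q: "1 \<le> q" and r0: "1 \<le> r0"
  shows "2 ^ j \<le> level q r0 (q * j)"
proof -
  have "(1 + 1 / real q) ^ k \<le> real (level q r0 k)" for k
  proof (induction k)
    case (Suc k)
    let ?l = "level q r0 k"
    have "(1 + 1 / real q) ^ Suc k \<le> real ?l * (1 + 1 / real q)"
      unfolding power_Suc2 using Suc by (intro mult_right_mono) auto
    also have "\<dots> = real ?l + real ?l / real q" by (simp add: field_simps)
    also have "\<dots> \<le> real ?l + (real (?l div q) + 1)"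
      using real_divide_le_Suc_div[of q ?l] q by simp
    finally show ?case by simp
  qed (use r0 in simp)
  moreover have "2 \<le> (1 + 1 / real q) ^ q"
    using Bernoulli_inequality[of "1 / real q" q] q by (simp add: order.trans[of "-1" 0])
  then have "2 ^ j \<le> ((1 + 1 / real q) ^ q) ^ j" by (intro power_mono) auto
  then have "2 ^ j \<le> (1 + 1 / real q) ^ (q * j)" by (simp add: power_mult)
  ultimately have "2 ^ j \<le> real (level q r0 (q * j))" by (rule order.trans[rotated])
  then show ?thesis by (metis of_nat_le_iff of_nat_numeral of_nat_power)
qed

text \<open>
The three terms account for a small local time at the origin, for two sides that both
fail to exceed the threshold at some grid value, and for an overshoot near the origin at some grid value.
The grid passes \<open>2^(j+1)\<close>, a trivial bound for the number of departures, after \<open>q * (j + 1)\<close> steps.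
\<close>

lemma prob_favorite_near_le:
  assumes fX: "fair_bits M X" and q: "1 \<le> q" and r0: "81 * q\<^sup>2 \<le> r0"
  shows "bit_prob M X (favorite_near h (2 ^ j) (2 ^ Suc j)) \<le>
    9 * real r0 / sqrt (2 ^ j) + 25 * (real j + 1) / real q
      + 6 * (real j + 1) * (real h + 1) * (real q) ^ 3 / real r0"
proof -
  let ?C = "coin_space :: (int \<times> nat \<Rightarrow> bool) measure" and ?\<eta> = "\<lambda>i \<omega>. \<omega> (i :: int \<times> nat) :: bool"
  let ?n = "2 ^ j :: nat" and ?n' = "2 ^ Suc j :: nat"
  let ?r = "level q r0" and ?m = "\<lambda>k. (level q r0 k + 4 * (level q r0 k div q)) div 2"
  let ?K = "q * Suc j"
  let ?bad = "\<lambda>k f. both_sides_small (?r k) (?m k) ?n' f \<or>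
     right_overshoot (?r (Suc k)) (?m k) h f \<or> right_overshoot (?r (Suc k)) (?m k) h (mirror_stacks f)"
  let ?low = "\<lambda>b. edge_local_time (walk_path b) 1 ?n < 2 * r0 + 1"
  have fC: "fair_bits ?C ?\<eta>" by (rule fair_bits_coin_space)
  have transfer: "bit_prob ?C ?\<eta> (\<lambda>f. Q (step_bit f)) = bit_prob M X Q"
    if Q: "depends_on Q {..<k}" for Q and k :: nat
  proof -
    have "bit_prob ?C ?\<eta> (\<lambda>f. Q (step_bit f)) = bit_prob ?C (\<lambda>k \<omega>. step_bit (\<lambda>i. ?\<eta> i \<omega>) k) Q"
      by (simp add: bit_prob_def)
    also have "\<dots> = bit_prob M X Q"
      unfolding bit_prob_eq_count[OF fair_on_step_bits[OF fC] Q]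
        bit_prob_eq_count[OF fair_bits_fair_on[OF fX, of "{..<k}", OF finite_lessThan] Q] ..
    finally show ?thesis .
  qed
  have r1: "1 \<le> r0" using one_le_power[OF q, of 2] r0 by linarith
  have dep_low: "depends_on ?low {..<?n}"
    using depends_on_crossings[of 0 ?n "2 * r0 + 1"] crossings_eq[of 0] by simp
  have fin_step: "finitary (\<lambda>f. Q (step_bit f))" if Q: "depends_on Q {..<k}" for Q and k :: nat
  proof -
    let ?I = "{A. A \<subseteq> {..<k} \<and> Q (\<lambda>i. i \<in> A)}"
    have "Q (step_bit f) \<longleftrightarrow> (\<exists>A\<in>?I. \<forall>i<k. step_bit f i = (i \<in> A))" for f
      unfolding depends_on_pattern[OF Q, of "step_bit f"] Ball_def lessThan_iff by blast
    moreover have "finitary (\<lambda>f. \<forall>i<k. step_bit f i = (i \<in> A))" for A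
      unfolding finitary_def using depends_on_follows[of k "\<lambda>i. i \<in> A"] by blast
    ultimately show ?thesis using finitary_Bex[of ?I "\<lambda>A f. \<forall>i<k. step_bit f i = (i \<in> A)"] by simp
  qed
  have fin_bad: "finitary (?bad k)" for k
    by (intro finitary_disj finitary_both_sides_small finitary_right_overshoot finitary_left_overshoot)
  have "bit_prob M X (favorite_near h ?n ?n') = bit_prob ?C ?\<eta> (\<lambda>f. favorite_near h ?n ?n' (step_bit f))"
    by (rule transfer[OF depends_on_favorite_near, symmetric])
  also have "\<dots> \<le> bit_prob ?C ?\<eta> (\<lambda>f. ?low (step_bit f) \<or> (\<exists>k\<in>{..<?K}. ?bad k f))"
  proof (rule bit_prob_mono[OF fC])
    show "finitary (\<lambda>f. ?low (step_bit f) \<or> (\<exists>k\<in>{..<?K}. ?bad k f))"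
      by (intro finitary_disj[OF fin_step[OF dep_low]] finitary_Bex fin_bad) simp
    fix f assume near: "favorite_near h ?n ?n' (step_bit f)"
    show "?low (step_bit f) \<or> (\<exists>k\<in>{..<?K}. ?bad k f)"
    proof (cases "?low (step_bit f)")
      case False
      then have "2 * r0 + 1 \<le> 2 * visits f ?n 0"
        using local_time_edge_1_le[of f ?n] by (simp add: position_eq_path)
      then have "?r 0 < visits f ?n 0" by simp
      from favorite_nearE[OF near this level_growth[OF q r1] order_refl, of ?m]
      show ?thesis by (metis lessThan_iff)
    qed simp
  qed
  also have "\<dots> \<le> bit_prob ?C ?\<eta> (\<lambda>f. ?low (step_bit f)) + bit_prob ?C ?\<eta> (\<lambda>f. \<exists>k\<in>{..<?K}. ?bad k f)"
    by (intro bit_prob_disj_le[OF fC] fin_step[OF dep_low] finitary_Bex fin_bad) simp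
  also have "bit_prob ?C ?\<eta> (\<lambda>f. ?low (step_bit f)) \<le> 9 * real r0 / sqrt (2 ^ j)"
  proof -
    define s where "s = sqrt (2 ^ j)"
    have s1: "1 \<le> s" by (simp add: s_def)
    have s2: "s * s = 2 ^ j" by (simp add: s_def)
    \<comment> \<open>A barrier at the diffusive scale balances the two terms of the estimate.\<close>
    define R where "R = nat \<lceil>s\<rceil>"
    have R: "s \<le> real R" "real R \<le> 2 * s" using s1 unfolding R_def by linarith+
    have "bit_prob M X ?low \<le> real (2 * r0 + 1) / real R + real (2 * r0 + 1) * real R / real ?n"
      using R(1) s1 by (intro prob_local_time_less[OF fX]) auto
    also have "\<dots> \<le> real (3 * r0) / s + real (3 * r0) * (2 * s) / real ?n"
      using R s1 r1 by (intro add_mono frac_le mult_mono) auto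
    also have "\<dots> = 9 * real r0 / s" using s1 by (simp add: s2[symmetric] field_simps)
    finally show ?thesis unfolding transfer[OF dep_low] s_def .
  qed
  also have "bit_prob ?C ?\<eta> (\<lambda>f. \<exists>k\<in>{..<?K}. ?bad k f) \<le> (\<Sum>k<?K. bit_prob ?C ?\<eta> (?bad k))"
    by (intro bit_prob_Bex_le[OF fC] fin_bad) simp
  also have "\<dots> \<le> (\<Sum>k<?K. 25 / (real q)\<^sup>2 + 6 * (real h + 1) * (real q)\<^sup>2 / real r0)"
  proof (intro sum_mono)
    fix k
    have "81 * q\<^sup>2 \<le> ?r k" using r0 level_ge[of r0 q k] by linarith
    then have "bit_prob ?C ?\<eta> (?bad k) \<le> 25 / (real q)\<^sup>2 + 6 * (real h + 1) * (real q)\<^sup>2 / real (?r k)"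
      by (intro level_error_bound[OF fC q]) auto
    also have "\<dots> \<le> 25 / (real q)\<^sup>2 + 6 * (real h + 1) * (real q)\<^sup>2 / real r0"
      using r1 level_ge[of r0 q k] by (intro add_left_mono divide_left_mono) auto
    finally show "bit_prob ?C ?\<eta> (?bad k) \<le> 25 / (real q)\<^sup>2 + 6 * (real h + 1) * (real q)\<^sup>2 / real r0" .
  qed
  also have "\<dots> = 25 * (real j + 1) / real q + 6 * (real j + 1) * (real h + 1) * (real q) ^ 3 / real r0"
    using q by (simp add: power2_eq_square power3_eq_cube field_simps)
  finally show ?thesis by simp
qed

lemma min_abs_favorite_edge_gt:
  assumes n: "1 \<le> n" "n0 \<le> n" "n < n'" and far: "\<not> favorite_near h n0 n' b"
  shows "int h < min_abs_favorite_edge (walk_path b) n"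
proof -
  let ?A = "{\<bar>x\<bar> | x. x \<in> favorite_edges (walk_path b) n}"
  have "?A = abs ` favorite_edges (walk_path b) n" by auto
  then have "finite ?A" "?A \<noteq> {}" using favorite_edges_finite_nonempty[OF n(1), of "walk_path b"] by auto
  moreover have "int h < a" if "a \<in> ?A" for a
    using that far n(2,3) unfolding favorite_near_def by (auto simp: not_le)
  ultimately show ?thesis unfolding min_abs_favorite_edge_def by simp
qed

text \<open>
With \<open>q\<close> of order \<open>j^(9/4)\<close> and a first grid value of order \<open>2^(j/2) j^(-3/2)\<close>, the three terms of
the preceding bound are of order \<open>j^(-3/2)\<close>, \<open>j^(-5/4)\<close> and \<open>j^(-7/4)\<close>.
\<close>

lemma summable_block_probabilities:
  assumes f: "fair_bits M X"
  shows "summable (\<lambda>j. bit_prob M X (favorite_near (nat \<lfloor>sqrt (2 ^ j) * real j powr (-11)\<rfloor>) (2 ^ j) (2 ^ Suc j)))"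
proof -
  define h where "h j = nat \<lfloor>sqrt (2 ^ j) * real j powr (-11)\<rfloor>" for j
  define q where "q j = nat \<lceil>real j powr (9/4)\<rceil>" for j
  define r where "r j = nat \<lceil>sqrt (2 ^ j) * real j powr (-3/2)\<rceil>" for j
  define Q where "Q j = real j powr (9/4)" for j
  define R where "R j = 2 powr (real j / 2) * real j powr (-3/2)" for j
  define H where "H j = 2 powr (real j / 2) * real j powr (-11)" for j
  define B where "B j = 9 * (R j + 1) / 2 powr (real j / 2) + 25 * (real j + 1) / Q j
      + 6 * (real j + 1) * (H j + 1) * (2 * Q j) ^ 3 / R j" for j
  have sqrt2: "sqrt (2 ^ j) = 2 powr (real j / 2)" for j
    by (simp add: powr_half_sqrt[symmetric] powr_realpow[symmetric] powr_powr)
  have bound: "bit_prob M X (favorite_near (h j) (2 ^ j) (2 ^ Suc j)) \<le> B j"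
    if j: "1 \<le> j" and large: "81 * (2 * Q j)\<^sup>2 \<le> R j" for j
  proof -
    have Q1: "1 \<le> Q j" unfolding Q_def using j by (intro ge_one_powr_ge_zero) auto
    have q: "Q j \<le> real (q j)" "real (q j) \<le> 2 * Q j"
      using Q1 unfolding q_def Q_def by linarith+
    have R0: "0 < R j" using j by (simp add: R_def)
    have r: "R j \<le> real (r j)" "real (r j) \<le> R j + 1"
      using R0 unfolding r_def R_def sqrt2 by linarith+
    have h: "real (h j) \<le> H j" unfolding h_def H_def sqrt2 by (simp add: of_nat_floor)
    have q1: "1 \<le> q j" using Q1 q(1) by linarith
    have "81 * (real (q j))\<^sup>2 \<le> 81 * (2 * Q j)\<^sup>2" using q(2) by (intro mult_left_mono power_mono) auto
    also have "\<dots> \<le> real (r j)" using large r(1) by linarith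
    finally have "real (81 * (q j)\<^sup>2) \<le> real (r j)" by simp
    then have "81 * (q j)\<^sup>2 \<le> r j" by (simp only: of_nat_le_iff)
    then have "bit_prob M X (favorite_near (h j) (2 ^ j) (2 ^ Suc j))
      \<le> 9 * real (r j) / sqrt (2 ^ j) + 25 * (real j + 1) / real (q j)
      + 6 * (real j + 1) * (real (h j) + 1) * (real (q j)) ^ 3 / real (r j)"
      by (rule prob_favorite_near_le[OF f q1])
    also have "\<dots> \<le> B j"
      unfolding B_def sqrt2 using q r h R0 Q1 j
      by (intro add_mono frac_le mult_mono power_mono add_nonneg_nonneg mult_nonneg_nonneg) auto
    finally show ?thesis .
  qed
  have "eventually (\<lambda>j. 81 * (2 * Q j)\<^sup>2 \<le> R j) sequentially"
    unfolding Q_def R_def by real_asymp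
  then have ev: "eventually (\<lambda>j. norm (bit_prob M X (favorite_near (h j) (2 ^ j) (2 ^ Suc j))) \<le> B j) sequentially"
    using eventually_ge_at_top[of 1] by eventually_elim (use bound in simp)
  have "B \<in> O(\<lambda>j. real j powr (-5/4))"
    unfolding B_def Q_def R_def H_def by real_asymp
  moreover have "summable (\<lambda>j. norm (real j powr (-5/4)))"
    by (simp add: summable_real_powr_iff)
  ultimately have "summable B" by (rule summable_comparison_test_bigo[rotated])
  then have "summable (\<lambda>j. bit_prob M X (favorite_near (h j) (2 ^ j) (2 ^ Suc j)))"
    by (rule summable_comparison_test_ev[OF ev])
  then show ?thesis by (simp add: h_def)
qed

section \<open>Almost sure escape of the favorite edges\<close>

context simple_symmetric_random_walk
begin

definition up_step :: "nat \<Rightarrow> 'a \<Rightarrow> bool" where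
  "up_step k \<omega> \<longleftrightarrow> S (Suc k) \<omega> - S k \<omega> = 1"

lemma fair_bits_up_step: "fair_bits M up_step"
proof (rule fair_bitsI_indep[OF prob_space_axioms])
  have "indep_vars (\<lambda>_. count_space UNIV) (\<lambda>k \<omega>. (\<lambda>d. d = 1) (S (Suc k) \<omega> - S k \<omega>)) UNIV"
    by (rule indep_vars_compose2[OF indep_steps]) simp
  then show "indep_vars (\<lambda>_. count_space UNIV) up_step UNIV"
    by (simp add: up_step_def[abs_def])
  show "prob {\<omega> \<in> space M. up_step k \<omega> = True} = 1 / 2" for k
    using step_up[of k] by (simp add: up_step_def)
qed

lemma AE_walk_eq_path: "AE \<omega> in M. \<forall>n. S n \<omega> = walk_path (\<lambda>k. up_step k \<omega>) n"
proof -
  have meas: "(\<lambda>\<omega>. S (Suc k) \<omega> - S k \<omega>) \<in> measurable M (count_space UNIV)" for k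
    using indep_steps by (auto simp: indep_vars_def)
  have sets: "{\<omega> \<in> space M. S (Suc k) \<omega> - S k \<omega> = d} \<in> sets M" for k d
    using measurable_sets[OF meas, of "{d}" k] by (simp add: vimage_def Int_def conj_commute)
  have "AE \<omega> in M. S (Suc k) \<omega> - S k \<omega> = 1 \<or> S (Suc k) \<omega> - S k \<omega> = - 1" for k
  proof -
    let ?E = "\<lambda>d. {\<omega> \<in> space M. S (Suc k) \<omega> - S k \<omega> = d}"
    have "prob (?E 1 \<union> ?E (- 1)) = prob (?E 1) + prob (?E (- 1))"
      by (rule finite_measure_Union[OF sets sets]) auto
    also have "\<dots> = 1" using step_up[of k] step_down[of k] by simp
    finally have "AE \<omega> in M. \<omega> \<in> ?E 1 \<union> ?E (- 1)"
      using sets by (intro AE_prob_1)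
    then show ?thesis by (rule AE_mp) (auto intro: AE_I2)
  qed
  then have "AE \<omega> in M. \<forall>k. S (Suc k) \<omega> - S k \<omega> = 1 \<or> S (Suc k) \<omega> - S k \<omega> = - 1"
    by (simp add: AE_all_countable)
  then show ?thesis
  proof (rule AE_mp, intro AE_I2 impI allI)
    fix \<omega> n
    assume \<omega>: "\<omega> \<in> space M" "\<forall>k. S (Suc k) \<omega> - S k \<omega> = 1 \<or> S (Suc k) \<omega> - S k \<omega> = - 1"
    show "S n \<omega> = walk_path (\<lambda>k. up_step k \<omega>) n"
    proof (induction n)
      case 0
      then show ?case using start[OF \<omega>(1)] by simp
    next
      case (Suc n)
      then show ?case using \<omega>(2)[rule_format, of n] by (auto simp: walk_path_Suc up_step_def)
    qed
  qed
qed

lemma AE_eventually_min_abs_favorite_edge_ge: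
  "AE \<omega> in M. eventually (\<lambda>n. sqrt (real n / 2) * (ln (real n) / ln 2) powr (-11)
      \<le> real_of_int (min_abs_favorite_edge (\<lambda>k. S k \<omega>) n)) sequentially"
proof -
  define h where "h j = nat \<lfloor>sqrt (2 ^ j) * real j powr (-11)\<rfloor>" for j
  let ?E = "\<lambda>j. {\<omega> \<in> space M. favorite_near (h j) (2 ^ j) (2 ^ Suc j) (\<lambda>k. up_step k \<omega>)}"
  have "AE \<omega> in M. eventually (\<lambda>j. \<omega> \<in> space M - ?E j) sequentially"
  proof (rule borel_cantelli_AE1)
    show "?E j \<in> sets M" for j
      by (rule fair_bits_event[OF fair_bits_up_step _ depends_on_favorite_near]) simp
    show "emeasure M (?E j) < \<infinity>" for j by (simp add: emeasure_eq_measure)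
    show "summable (\<lambda>j. measure M (?E j))"
      using summable_block_probabilities[OF fair_bits_up_step] by (simp add: bit_prob_def h_def)
  qed
  with AE_walk_eq_path show ?thesis
  proof eventually_elim
    case (elim \<omega>)
    then have walk_path: "(\<lambda>k. S k \<omega>) = walk_path (\<lambda>k. up_step k \<omega>)" by auto
    from elim(2) obtain J where J: "\<And>j. J \<le> j \<Longrightarrow> \<not> favorite_near (h j) (2 ^ j) (2 ^ Suc j) (\<lambda>k. up_step k \<omega>)"
      by (auto simp: eventually_sequentially)
    show ?case
    proof (rule eventually_sequentiallyI[of "2 ^ Suc J"])
      fix n :: nat assume n: "2 ^ Suc J \<le> n"
      then have n1: "1 \<le> n" using one_le_power[of "2::nat" "Suc J"] by linarith
      obtain j where j: "2 ^ j \<le> n" "n < 2 ^ (j + 1)" using ex_power_ivl1[of 2 n] n1 by auto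
      have "(2::nat) ^ Suc J < 2 ^ (j + 1)" using n j(2) by linarith
      then have Jj: "J < j" by simp
      have rn: "2 ^ j \<le> real n" "real n < 2 * 2 ^ j"
        using j by (metis of_nat_le_iff of_nat_numeral of_nat_power)
          (metis j(2) of_nat_less_iff of_nat_numeral of_nat_power power_Suc Suc_eq_plus1)
      have "sqrt (real n / 2) * (ln (real n) / ln 2) powr (-11) \<le> sqrt (2 ^ j) * real j powr (-11)"
      proof (intro mult_mono)
        show "sqrt (real n / 2) \<le> sqrt (2 ^ j)" using rn by simp
        have "ln (2 ^ j) \<le> ln (real n)" using rn n1 by simp
        then have "real j \<le> ln (real n) / ln 2" by (simp add: ln_realpow field_simps)
        then show "(ln (real n) / ln 2) powr (-11) \<le> real j powr (-11)"
          using Jj by (intro powr_mono2') auto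
      qed auto
      also have "\<dots> \<le> real_of_int (int (h j) + 1)" unfolding h_def by linarith
      also have "\<dots> \<le> real_of_int (min_abs_favorite_edge (walk_path (\<lambda>k. up_step k \<omega>)) n)"
      proof -
        have "int (h j) < min_abs_favorite_edge (walk_path (\<lambda>k. up_step k \<omega>)) n"
          using n1 j Jj by (intro min_abs_favorite_edge_gt[OF _ _ _ J[of j]]) auto
        then show ?thesis by linarith
      qed
      finally show "sqrt (real n / 2) * (ln (real n) / ln 2) powr (-11)
        \<le> real_of_int (min_abs_favorite_edge (\<lambda>k. S k \<omega>) n)" unfolding walk_path .
    qed
  qed
qed

end

theorem theorem2p1:
  fixes M :: "'a measure" and S :: "nat \<Rightarrow> 'a \<Rightarrow> int" and \<gamma> :: real
  assumes "simple_symmetric_random_walk M S"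
    and "\<gamma> > 11"
  shows "AE \<omega> in M.
    liminf (\<lambda>n. ereal (real_of_int (min_abs_favorite_edge (\<lambda>k. S k \<omega>) n)
                        / (sqrt (real n) * ln (real n) powr (- \<gamma>)))) = \<infinity>"
proof -
  interpret simple_symmetric_random_walk M S by fact
  from AE_eventually_min_abs_favorite_edge_ge show ?thesis
  proof eventually_elim
    case (elim \<omega>)
    let ?U = "\<lambda>n. real_of_int (min_abs_favorite_edge (\<lambda>k. S k \<omega>) n)"
    let ?g = "\<lambda>n. sqrt (real n) * ln (real n) powr (- \<gamma>)"
    let ?l = "\<lambda>n. sqrt (real n / 2) * (ln (real n) / ln 2) powr (-11)"
    have "filterlim (\<lambda>n::nat. ?l n / ?g n) at_top sequentially"
      using assms(2) by real_asymp
    moreover have "eventually (\<lambda>n. ?l n / ?g n \<le> ?U n / ?g n) sequentially"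
      using elim by eventually_elim (rule divide_right_mono, auto)
    ultimately have "filterlim (\<lambda>n. ?U n / ?g n) at_top sequentially"
      by (rule filterlim_at_top_mono)
    then have "((\<lambda>n. ereal (?U n / ?g n)) \<longlongrightarrow> \<infinity>) sequentially"
      by (simp add: tendsto_PInfty_eq_at_top)
    then show ?case by (intro lim_imp_Liminf) auto
  qed
qed

end
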